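(* Let $\Delta$ be a connected simplicial complex which is a locally complete intersection complex. (i) If $\dim \Delta \ge 2$, then $\Delta$ is a complete intersection complex. (ii) If $\dim \Delta = 1$, then $\Delta$ is (up to relabelling of the vertices) an $n$-gon for some $n \ge 3$ or an $n$-pointed path for some $n \ge 2$.
   Context: A simplicial complex $\Delta$ on a vertex set $V=[n]=\{1,\dots,n\}$ is a nonempty family of subsets of $V$ such that $\{v\}\in\Delta$ for every $v\in V$, and $F\in\Delta$, $G\subseteq F$ imply $G\in\Delta$. The dimension of a face $F$ is $\sharp(F)-1$, and $\dim\Delta$ is the maximum of the dimensions of its faces. $\Delta$ is pure if all its facets (maximal faces) have the same dimension. $\Delta$ is connected if any two vertices can be joined by a path of edges (faces of dimension 1) of $\Delta$. Fix a field $K$ and let $S=K[X_1,\dots,X_n]$. The Stanley--Reisner ideal $I_\Delta\subseteq S$ is generated by all squarefree monomials $X_{i_1}\cdots X_{i_p}$ ($i_1<\cdots<i_p$) with $\{i_1,\dots,i_p\}\notin\Delta$. The link of a face $F$ is $\mathrm{link}_\Delta(F)=\{G\in\Delta : G\cup F\in\Delta,\ G\cap F=\emptyset\}$, regarded as a simplicial complex on the set of its own vertices. $\Delta$ is a complete intersection complex if $I_\Delta$ is generated by a regular sequence (the zero ideal is allowed, as generated by the empty sequence). $\Delta$ is a locally complete intersection complex if $\mathrm{link}_\Delta(\{i\})$ is a complete intersection complex for every vertex $i\in V$. A one-dimensional simplicial complex on $[n]$ is the $n$-gon ($n\ge 3$), resp. the $n$-pointed path ($n\ge 2$), if it is pure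 and, after a suitable relabelling of vertices, its facets are $\{i,i+1\}$ ($i=1,\dots,n-1$) and $\{n,1\}$, resp. its facets are $\{i,i+1\}$ ($i=1,\dots,n-1$). *)

theory Defs
  imports "HOL-Library.Poly_Mapping" "HOL-Algebra.Ideal"
begin

section \<open>Simplicial complexes\<close>

definition simplicial_complex :: "'v set \<Rightarrow> 'v set set \<Rightarrow> bool" where
  "simplicial_complex V \<Delta> \<longleftrightarrow>
     finite V \<and> \<Delta> \<noteq> {} \<and> \<Delta> \<subseteq> Pow V \<and> (\<forall>v\<in>V. {v} \<in> \<Delta>) \<and>
     (\<forall>F\<in>\<Delta>. \<forall>G. G \<subseteq> F \<longrightarrow> G \<in> \<Delta>)"

text \<open>Dimensions are integers, so that the empty face has dimension \<open>-1\<close>.\<close>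

definition face_dim :: "'v set \<Rightarrow> int" where
  "face_dim F = int (card F) - 1"

definition complex_dim :: "'v set set \<Rightarrow> int" where
  "complex_dim \<Delta> = Max (face_dim ` \<Delta>)"

definition facets :: "'v set set \<Rightarrow> 'v set set" where
  "facets \<Delta> = {F \<in> \<Delta>. \<forall>G\<in>\<Delta>. F \<subseteq> G \<longrightarrow> G = F}"

definition pure_complex :: "'v set set \<Rightarrow> bool" where
  "pure_complex \<Delta> \<longleftrightarrow> (\<forall>F\<in>facets \<Delta>. \<forall>G\<in>facets \<Delta>. face_dim F = face_dim G)"

definition connected_complex :: "'v set \<Rightarrow> 'v set set \<Rightarrow> bool" where
  "connected_complex V \<Delta> \<longleftrightarrow>
     (\<forall>u\<in>V. \<forall>v\<in>V. (u, v) \<in> {(x, y). x \<noteq> y \<and> {x, y} \<in> \<Delta>}\<^sup>*)"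

definition link :: "'v set set \<Rightarrow> 'v set \<Rightarrow> 'v set set" where
  "link \<Delta> F = {G \<in> \<Delta>. G \<union> F \<in> \<Delta> \<and> G \<inter> F = {}}"

definition vertices :: "'v set set \<Rightarrow> 'v set" where
  "vertices \<Delta> = {v. {v} \<in> \<Delta>}"

text \<open>The bijection \<open>f\<close> below is the relabelling of the vertices.\<close>

definition is_gon :: "nat \<Rightarrow> 'v set \<Rightarrow> 'v set set \<Rightarrow> bool" where
  "is_gon m V \<Delta> \<longleftrightarrow> complex_dim \<Delta> = 1 \<and> pure_complex \<Delta> \<and>
     (\<exists>f. bij_betw f {1..m} V \<and>
       facets \<Delta> = (`) f ` ({{i, i + 1} | i. i \<in> {1..<m}} \<union> {{m, 1}}))"

definition is_pointed_path :: "nat \<Rightarrow> 'v set \<Rightarrow> 'v set set \<Rightarrow> bool" where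
  "is_pointed_path m V \<Delta> \<longleftrightarrow> complex_dim \<Delta> = 1 \<and> pure_complex \<Delta> \<and>
     (\<exists>f. bij_betw f {1..m} V \<and>
       facets \<Delta> = (`) f ` {{i, i + 1} | i. i \<in> {1..<m}})"


section \<open>Polynomial rings and Stanley--Reisner ideals\<close>

text \<open>
  A monomial is a finitely supported exponent function of type \<open>'v \<Rightarrow>\<^sub>0 nat\<close>. The ring
  \<open>poly_ring V\<close> is \<open>K[X\<^sub>v | v \<in> V]\<close>: its elements are the finitely supported
  coefficient functions all of whose monomials only involve variables from \<open>V\<close>.
\<close>

type_synonym ('v, 'k) mpoly = "('v \<Rightarrow>\<^sub>0 nat) \<Rightarrow>\<^sub>0 'k"

definition poly_ring :: "'v set \<Rightarrow> ('v, 'k::field) mpoly ring" where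
  "poly_ring V =
     \<lparr>carrier = {p. \<forall>m \<in> Poly_Mapping.keys p. Poly_Mapping.keys m \<subseteq> V},
      mult = (*), one = 1, zero = 0, add = (+)\<rparr>"

lemma poly_ring_cring: "cring (poly_ring V :: ('v, 'k::field) mpoly ring)"
proof -
  let ?R = "poly_ring V :: ('v, 'k) mpoly ring"
  let ?C = "{p :: ('v, 'k) mpoly. \<forall>m \<in> Poly_Mapping.keys p. Poly_Mapping.keys m \<subseteq> V}"
  have simps: "carrier ?R = ?C" "mult ?R = (*)" "one ?R = 1" "zero ?R = 0" "add ?R = (+)"
    by (simp_all add: poly_ring_def)
  have mult: "p * q \<in> ?C" if p: "p \<in> ?C" and q: "q \<in> ?C" for p q
  proof (rule CollectI, rule ballI)
    fix m assume "m \<in> Poly_Mapping.keys (p * q)"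
    then obtain a b where m: "m = a + b"
      and a: "a \<in> Poly_Mapping.keys p" and b: "b \<in> Poly_Mapping.keys q"
      using keys_mult[of p q] by blast
    have "Poly_Mapping.keys a \<union> Poly_Mapping.keys b \<subseteq> V"
      using p q a b by simp
    with keys_add[of a b] show "Poly_Mapping.keys m \<subseteq> V"
      unfolding m by (rule subset_trans)
  qed
  have add: "p + q \<in> ?C" if "p \<in> ?C" and "q \<in> ?C" for p q
    using that keys_add[of p q] by auto
  have inv: "\<exists>q \<in> ?C. q + p = 0" if "p \<in> ?C" for p
    using that by (intro bexI[of _ "- p"]) simp_all
  have ids: "0 \<in> ?C" "1 \<in> ?C"
    by simp_all
  show ?thesis
  proof (rule cringI)
    show "abelian_group ?R"
      by (rule abelian_groupI; unfold simps)
        (rule add ids inv add.assoc add.commute add_0; assumption)+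
    show "comm_monoid ?R"
      by (rule comm_monoidI; unfold simps)
        (rule mult ids mult.assoc mult.commute mult_1; assumption)+
  qed (unfold simps, rule distrib_right)
qed

definition squarefree_monom :: "'v set \<Rightarrow> ('v, 'k::field) mpoly" where
  "squarefree_monom F = Poly_Mapping.single (\<Sum>v\<in>F. Poly_Mapping.single v 1) 1"

definition stanley_reisner_ideal :: "'v set \<Rightarrow> 'v set set \<Rightarrow> ('v, 'k::field) mpoly set" where
  "stanley_reisner_ideal V \<Delta> =
     Idl\<^bsub>poly_ring V\<^esub> (squarefree_monom ` {F. F \<subseteq> V \<and> F \<notin> \<Delta>})"


section \<open>Regular sequences and complete intersection complexes\<close>

text \<open>
  Every \<open>fs ! i\<close> is a nonzerodivisor modulo the ideal generated by its predecessors, and the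
  whole sequence generates a proper ideal.
\<close>

definition regular_sequence :: "('a, 'b) ring_scheme \<Rightarrow> 'a list \<Rightarrow> bool" where
  "regular_sequence R fs \<longleftrightarrow>
     set fs \<subseteq> carrier R \<and>
     Idl\<^bsub>R\<^esub> (set fs) \<noteq> carrier R \<and>
     (\<forall>i < length fs. \<forall>g \<in> carrier R.
        fs ! i \<otimes>\<^bsub>R\<^esub> g \<in> Idl\<^bsub>R\<^esub> (set (take i fs)) \<longrightarrow> g \<in> Idl\<^bsub>R\<^esub> (set (take i fs)))"

text \<open>The \<open>itself\<close> argument fixes the coefficient field.\<close>

definition complete_intersection_complex ::
    "'k::field itself \<Rightarrow> 'v set \<Rightarrow> 'v set set \<Rightarrow> bool" where
  "complete_intersection_complex _ V \<Delta> \<longleftrightarrow>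
     (\<exists>fs :: ('v, 'k) mpoly list.
        regular_sequence (poly_ring V) fs \<and>
        stanley_reisner_ideal V \<Delta> = Idl\<^bsub>poly_ring V\<^esub> (set fs))"

definition locally_complete_intersection_complex ::
    "'k::field itself \<Rightarrow> 'v set \<Rightarrow> 'v set set \<Rightarrow> bool" where
  "locally_complete_intersection_complex K V \<Delta> \<longleftrightarrow>
     (\<forall>i\<in>V. complete_intersection_complex K (vertices (link \<Delta> {i})) (link \<Delta> {i}))"

end

theory Submission
  imports Defs
begin

text \<open>
  The notion of complete intersection complex is first made combinatorial: for any field, a
  complex is a complete intersection complex iff its minimal nonfaces are pairwise disjoint
  (\<open>complete_intersection_imp_disjoint\<close>, \<open>disjoint_imp_complete_intersection\<close>). One direction holds
  because monomials with disjoint supports form a regular sequence. For the other, the coefficients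
  of a syzygy of a regular sequence lie in the ideal \<open>I\<close> that the sequence generates
  (\<open>regular_sequence_syzygy\<close>), whereas the syzygy between two generating monomials of \<open>I\<close> with a
  common variable has coefficients that are monomials outside \<open>I\<close>.

  Thus, in the link of every vertex, the minimal nonfaces are pairwise disjoint. Suppose that two
  different minimal nonfaces \<open>F\<close> and \<open>G\<close> of the complex share a vertex. If one of them, say \<open>F\<close>, has
  at least three elements, then by connectedness every vertex outside \<open>F\<close> is adjacent to all of \<open>F\<close>
  (\<open>large_nonface_dominates\<close>). Hence \<open>G\<close> is not a nonedge, and the case of two large nonfaces is
  excluded by looking at the link of a vertex of \<open>F - G\<close>. So \<open>F\<close> and \<open>G\<close> are nonedges. If the
  dimension is at least two, then every vertex lies in a triangle, which makes the diameter of the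
  1-skeleton at most two (\<open>diameter_two\<close>) and leaves each vertex with at most one nonneighbour
  (\<open>nonadjacent_unique\<close>), contrary to \<open>F \<noteq> G\<close>.

  In dimension one the link of a vertex consists of isolated points, any two of which form a minimal
  nonface, so there are at most two of them. A connected graph in which every vertex has at most two
  neighbours is a path or a cycle, as one sees from a longest path in it (\<open>spanning_path\<close>).
\<close>


section \<open>Ideals of the polynomial ring\<close>

lemma poly_ring_simps:
  "mult (poly_ring V :: ('v, 'k::field) mpoly ring) = (*)"
  "one (poly_ring V :: ('v, 'k::field) mpoly ring) = 1"
  "zero (poly_ring V :: ('v, 'k::field) mpoly ring) = 0"
  "add (poly_ring V :: ('v, 'k::field) mpoly ring) = (+)"
  by (simp_all add: poly_ring_def)

lemma carrier_poly_ring_iff: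
  "p \<in> carrier (poly_ring V) \<longleftrightarrow>
     (\<forall>m \<in> Poly_Mapping.keys p. Poly_Mapping.keys m \<subseteq> V)"
  by (simp add: poly_ring_def)

lemma poly_ring_closed:
  fixes p q :: "('v, 'k::field) mpoly"
  shows "0 \<in> carrier (poly_ring V :: ('v, 'k) mpoly ring)"
    and "1 \<in> carrier (poly_ring V :: ('v, 'k) mpoly ring)"
    and "p \<in> carrier (poly_ring V) \<Longrightarrow> - p \<in> carrier (poly_ring V)"
    and "p \<in> carrier (poly_ring V) \<Longrightarrow> q \<in> carrier (poly_ring V) \<Longrightarrow> p + q \<in> carrier (poly_ring V)"
    and "p \<in> carrier (poly_ring V) \<Longrightarrow> q \<in> carrier (poly_ring V) \<Longrightarrow> p - q \<in> carrier (poly_ring V)"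
    and "p \<in> carrier (poly_ring V) \<Longrightarrow> q \<in> carrier (poly_ring V) \<Longrightarrow> p * q \<in> carrier (poly_ring V)"
proof -
  interpret R: cring "poly_ring V :: ('v, 'k) mpoly ring" by (rule poly_ring_cring)
  show "0 \<in> carrier (poly_ring V :: ('v, 'k) mpoly ring)"
    using R.zero_closed by (simp add: poly_ring_simps)
  show "1 \<in> carrier (poly_ring V :: ('v, 'k) mpoly ring)"
    using R.one_closed by (simp add: poly_ring_simps)
  show neg: "- p \<in> carrier (poly_ring V)" if "p \<in> carrier (poly_ring V)" for p :: "('v, 'k) mpoly"
    using that by (simp add: carrier_poly_ring_iff)
  show add: "p + q \<in> carrier (poly_ring V)"
    if "p \<in> carrier (poly_ring V)" "q \<in> carrier (poly_ring V)" for p q :: "('v, 'k) mpoly"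
    using R.a_closed[OF that] by (simp add: poly_ring_simps)
  show "p - q \<in> carrier (poly_ring V)"
    if "p \<in> carrier (poly_ring V)" "q \<in> carrier (poly_ring V)"
    using add[OF that(1) neg[OF that(2)]] by simp
  show "p * q \<in> carrier (poly_ring V)"
    if "p \<in> carrier (poly_ring V)" "q \<in> carrier (poly_ring V)"
    using R.m_closed[OF that] by (simp add: poly_ring_simps)
qed

lemma ideal_poly_ringI:
  fixes I :: "('v, 'k::field) mpoly set"
  assumes sub: "I \<subseteq> carrier (poly_ring V)" and zero: "0 \<in> I"
    and add: "\<And>p q. p \<in> I \<Longrightarrow> q \<in> I \<Longrightarrow> p + q \<in> I"
    and mult: "\<And>p q. p \<in> carrier (poly_ring V) \<Longrightarrow> q \<in> I \<Longrightarrow> p * q \<in> I"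
  shows "ideal I (poly_ring V)"
proof -
  interpret R: cring "poly_ring V :: ('v, 'k) mpoly ring" by (rule poly_ring_cring)
  have inv: "\<ominus>\<^bsub>poly_ring V\<^esub> p \<in> I" if "p \<in> I" for p
  proof -
    have "\<ominus>\<^bsub>poly_ring V\<^esub> p = - p"
      using that sub by (intro R.minus_equality) (auto simp: poly_ring_simps poly_ring_closed)
    moreover have "(- 1) * p \<in> I"
      using mult[OF poly_ring_closed(3)[OF poly_ring_closed(2)] that] .
    ultimately show ?thesis by simp
  qed
  show ?thesis
  proof (rule idealI)
    show "subgroup I (add_monoid (poly_ring V))"
    proof (rule subgroup.intro)
      show "I \<subseteq> carrier (add_monoid (poly_ring V))"
        using sub by simp
      show "\<one>\<^bsub>add_monoid (poly_ring V)\<^esub> \<in> I"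
        using zero by (simp add: poly_ring_simps)
      show "x \<otimes>\<^bsub>add_monoid (poly_ring V)\<^esub> y \<in> I" if "x \<in> I" "y \<in> I" for x y
        using add[OF that] by (simp add: poly_ring_simps)
      show "inv\<^bsub>add_monoid (poly_ring V)\<^esub> x \<in> I" if "x \<in> I" for x
        using inv[OF that] by (simp add: a_inv_def)
    qed
  next
    show "x \<otimes>\<^bsub>poly_ring V\<^esub> a \<in> I" if "a \<in> I" "x \<in> carrier (poly_ring V)" for a x
      using mult[OF that(2,1)] by (simp add: poly_ring_simps)
    show "a \<otimes>\<^bsub>poly_ring V\<^esub> x \<in> I" if "a \<in> I" "x \<in> carrier (poly_ring V)" for a x
      using mult[OF that(2,1)] by (simp add: poly_ring_simps mult.commute)
  qed (rule R.ring_axioms)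
qed

lemma ideal_poly_ringD:
  fixes I :: "('v, 'k::field) mpoly set"
  assumes "ideal I (poly_ring V)"
  shows "0 \<in> I"
    and "p \<in> I \<Longrightarrow> q \<in> I \<Longrightarrow> p + q \<in> I"
    and "p \<in> I \<Longrightarrow> q \<in> I \<Longrightarrow> p - q \<in> I"
    and "p \<in> carrier (poly_ring V) \<Longrightarrow> q \<in> I \<Longrightarrow> p * q \<in> I"
    and "finite X \<Longrightarrow> (\<And>x. x \<in> X \<Longrightarrow> g x \<in> I) \<Longrightarrow> sum g X \<in> I"
proof -
  note sub = ideal.axioms(1)[OF assms]
  show zero: "0 \<in> I"
    using additive_subgroup.zero_closed[OF sub]
    by (simp add: poly_ring_simps)
  show add: "p + q \<in> I" if "p \<in> I" "q \<in> I" for p q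
    using additive_subgroup.a_closed[OF sub that] by (simp add: poly_ring_simps)
  show mult: "p * q \<in> I" if "p \<in> carrier (poly_ring V)" "q \<in> I" for p q
    using ideal.I_l_closed[OF assms that(2,1)] by (simp add: poly_ring_simps)
  show "p - q \<in> I" if "p \<in> I" "q \<in> I"
    using add[OF that(1) mult[OF _ that(2), of "- 1"]] by (simp add: poly_ring_closed)
  show "sum g X \<in> I" if "finite X" "\<And>x. x \<in> X \<Longrightarrow> g x \<in> I"
    using that by (induction X rule: finite_induct) (auto simp: zero add)
qed

text \<open>
  In \<open>genideal_list_eq\<close> and below, the coefficients of a linear combination are given by a
  function on all of \<open>nat\<close>; its values beyond the length of the list play no role.
\<close>

lemma genideal_list_eq:
  fixes fs :: "('v, 'k::field) mpoly list"
  assumes fs: "set fs \<subseteq> carrier (poly_ring V)"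
  shows "Idl\<^bsub>poly_ring V\<^esub> (set fs) =
    {\<Sum>i<length fs. c i * fs ! i | c. \<forall>i. c i \<in> carrier (poly_ring V)}" (is "_ = ?J")
proof
  interpret R: cring "poly_ring V :: ('v, 'k) mpoly ring" by (rule poly_ring_cring)
  have gen: "ideal (Idl\<^bsub>poly_ring V\<^esub> (set fs)) (poly_ring V)"
    using fs by (rule R.genideal_ideal)
  have fs_gen: "set fs \<subseteq> Idl\<^bsub>poly_ring V\<^esub> (set fs)"
    using fs by (rule R.genideal_self)
  show J: "?J \<subseteq> Idl\<^bsub>poly_ring V\<^esub> (set fs)"
  proof
    fix p assume "p \<in> ?J"
    then obtain c where p: "p = (\<Sum>i<length fs. c i * fs ! i)"
      and c: "\<forall>i. c i \<in> carrier (poly_ring V)" by blast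
    show "p \<in> Idl\<^bsub>poly_ring V\<^esub> (set fs)"
      unfolding p using c fs_gen
      by (intro ideal_poly_ringD(5)[OF gen] ideal_poly_ringD(4)[OF gen]) auto
  qed
  have "ideal ?J (poly_ring V)"
  proof (rule ideal_poly_ringI)
    show "?J \<subseteq> carrier (poly_ring V)"
      using subset_trans[OF J additive_subgroup.a_subset[OF ideal.axioms(1)[OF gen]]] .
    have "0 = (\<Sum>i<length fs. (0 :: ('v, 'k) mpoly) * fs ! i)" by simp
    then show "0 \<in> ?J"
      using poly_ring_closed(1) by (intro CollectI exI[of _ "\<lambda>_. 0"] conjI allI)
  next
    fix p q :: "('v, 'k) mpoly" assume pJ: "p \<in> ?J" and qJ: "q \<in> ?J"
    obtain c where p: "p = (\<Sum>i<length fs. c i * fs ! i)"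
      and c: "\<forall>i. c i \<in> carrier (poly_ring V)" using pJ by blast
    obtain d where q: "q = (\<Sum>i<length fs. d i * fs ! i)"
      and d: "\<forall>i. d i \<in> carrier (poly_ring V)" using qJ by blast
    have "p + q = (\<Sum>i<length fs. (c i + d i) * fs ! i)"
      unfolding p q by (simp only: distrib_right sum.distrib)
    moreover have "\<forall>i. c i + d i \<in> carrier (poly_ring V)"
      using c d poly_ring_closed(4) by blast
    ultimately show "p + q \<in> ?J" by (intro CollectI exI[of _ "\<lambda>i. c i + d i"] conjI)
  next
    fix p q :: "('v, 'k) mpoly" assume pc: "p \<in> carrier (poly_ring V)" and "q \<in> ?J"
    then obtain d where q: "q = (\<Sum>i<length fs. d i * fs ! i)"
      and d: "\<forall>i. d i \<in> carrier (poly_ring V)" by blast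
    have "p * q = (\<Sum>i<length fs. (p * d i) * fs ! i)"
      unfolding q by (simp only: sum_distrib_left mult.assoc)
    moreover have "\<forall>i. p * d i \<in> carrier (poly_ring V)"
      using pc d poly_ring_closed(6) by blast
    ultimately show "p * q \<in> ?J" by (intro CollectI exI[of _ "\<lambda>i. p * d i"] conjI)
  qed
  moreover have "set fs \<subseteq> ?J"
  proof
    fix f assume "f \<in> set fs"
    then obtain j where j: "j < length fs" "f = fs ! j" by (metis in_set_conv_nth)
    have "f = (\<Sum>i<length fs. (if i = j then 1 else 0) * fs ! i)"
      using j by (simp add: if_distrib[of "\<lambda>x. x * _"] sum.delta cong: if_cong)
    moreover have "\<forall>i. (if i = j then 1 else 0) \<in> carrier (poly_ring V)"
      by (simp add: poly_ring_closed)
    ultimately show "f \<in> ?J"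
      by (intro CollectI exI[of _ "\<lambda>i. if i = j then 1 else 0"] conjI)
  qed
  ultimately show "Idl\<^bsub>poly_ring V\<^esub> (set fs) \<subseteq> ?J"
    by (rule R.genideal_minimal)
qed

lemma genideal_take_eq:
  fixes fs :: "('v, 'k::field) mpoly list"
  assumes "set fs \<subseteq> carrier (poly_ring V)" "k \<le> length fs"
  shows "Idl\<^bsub>poly_ring V\<^esub> (set (take k fs)) =
    {\<Sum>i<k. c i * fs ! i | c. \<forall>i. c i \<in> carrier (poly_ring V)}"
proof -
  have "set (take k fs) \<subseteq> carrier (poly_ring V)"
    using assms(1) set_take_subset[of k fs] by blast
  moreover have "(\<Sum>i<k. c i * take k fs ! i) = (\<Sum>i<k. c i * fs ! i)" for c
    by (rule sum.cong) auto
  ultimately show ?thesis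
    using assms(2) genideal_list_eq[of "take k fs" V] by (simp add: min_absorb2)
qed

text \<open>
  The first Koszul homology of a regular sequence vanishes, so the coefficients of a syzygy lie in
  the ideal generated by the sequence. Equivalently, for \<open>k\<close> the full length of \<open>fs\<close> and
  \<open>I\<close> the ideal generated by \<open>fs\<close>, the module \<open>I/I\<^sup>2\<close> is free over the quotient ring modulo
  \<open>I\<close>.
\<close>

lemma regular_sequence_syzygy:
  fixes fs :: "('v, 'k::field) mpoly list"
  assumes reg: "regular_sequence (poly_ring V) fs"
    and "k \<le> length fs" and "\<And>i. a i \<in> carrier (poly_ring V)"
    and "(\<Sum>i<k. a i * fs ! i) = 0" and "j < k"
  shows "a j \<in> Idl\<^bsub>poly_ring V\<^esub> (set (take k fs))"
  using assms(2-)
proof (induction k arbitrary: a j)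
  case 0
  then show ?case by simp
next
  case (Suc k)
  interpret R: cring "poly_ring V :: ('v, 'k) mpoly ring" by (rule poly_ring_cring)
  let ?I = "\<lambda>k. Idl\<^bsub>poly_ring V\<^esub> (set (take k fs))"
  have fs: "set fs \<subseteq> carrier (poly_ring V)"
    and nzd: "\<And>g. g \<in> carrier (poly_ring V) \<Longrightarrow> fs ! k * g \<in> ?I k \<Longrightarrow> g \<in> ?I k"
    using reg Suc.prems(1) by (auto simp: regular_sequence_def poly_ring_simps)
  have take_carr: "set (take i fs) \<subseteq> carrier (poly_ring V)" for i
    using fs set_take_subset[of i fs] by blast
  have ideal: "ideal (?I i) (poly_ring V)" for i
    by (intro R.genideal_ideal take_carr)
  have mono: "?I k \<subseteq> ?I (Suc k)"
    by (intro R.subset_Idl_subset take_carr set_take_subset_set_take) simp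
  have fk: "fs ! k \<in> carrier (poly_ring V)" "fs ! k \<in> ?I (Suc k)"
    using Suc.prems(1) fs R.genideal_self[OF take_carr[of "Suc k"]]
    by (auto simp: take_Suc_conv_app_nth)
  have "fs ! k * a k = (\<Sum>i<k. - a i * fs ! i)"
    using Suc.prems(3) by (simp add: sum_negf eq_neg_iff_add_eq_0 algebra_simps)
  moreover have "\<forall>i. - a i \<in> carrier (poly_ring V)"
    using Suc.prems(2) by (simp add: poly_ring_closed)
  ultimately have "fs ! k * a k \<in> ?I k"
    using genideal_take_eq[OF fs, of k] Suc.prems(1) by (auto intro!: exI[of _ "\<lambda>i. - a i"])
  then have ak: "a k \<in> ?I k"
    using nzd Suc.prems(2) by blast
  then obtain b where b: "a k = (\<Sum>i<k. b i * fs ! i)" "\<forall>i. b i \<in> carrier (poly_ring V)"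
    using genideal_take_eq[OF fs, of k] Suc.prems(1) by auto
  \<comment> \<open>Replacing \<open>a k\<close> by this combination yields a syzygy of the first \<open>k\<close> elements.\<close>
  have "(\<Sum>i<k. (a i + b i * fs ! k) * fs ! i) = (\<Sum>i<k. a i * fs ! i) + a k * fs ! k"
    unfolding b(1) by (simp add: algebra_simps sum.distrib sum_distrib_left)
  then have zero: "(\<Sum>i<k. (a i + b i * fs ! k) * fs ! i) = 0"
    using Suc.prems(3) by simp
  show ?case
  proof (cases "j = k")
    case True
    then show ?thesis using ak mono by blast
  next
    case False
    have "a j + b j * fs ! k \<in> ?I k"
      using Suc.prems False b(2) fk(1) zero
      by (intro Suc.IH) (auto simp: poly_ring_closed)
    then have "a j + b j * fs ! k - b j * fs ! k \<in> ?I (Suc k)"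
      using mono b(2) fk(2) ideal
      by (intro ideal_poly_ringD(3)[OF ideal] ideal_poly_ringD(4)[OF ideal]) auto
    then show ?thesis by simp
  qed
qed


section \<open>Ideals generated by squarefree monomials\<close>

text \<open>
  The exponent function of the squarefree monomial with support \<open>F\<close>; it is meaningful for
  finite \<open>F\<close> only, since a sum over an infinite set is \<open>0\<close>.
\<close>

definition squarefree_exponent :: "'v set \<Rightarrow> 'v \<Rightarrow>\<^sub>0 nat" where
  "squarefree_exponent F = (\<Sum>v\<in>F. Poly_Mapping.single v 1)"

lemma squarefree_monom_eq:
  "squarefree_monom F = Poly_Mapping.single (squarefree_exponent F) 1"
  by (simp add: squarefree_monom_def squarefree_exponent_def)

lemma lookup_squarefree_exponent:
  "finite F \<Longrightarrow> Poly_Mapping.lookup (squarefree_exponent F) v = (if v \<in> F then 1 else 0)"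
  by (simp add: squarefree_exponent_def lookup_sum lookup_single when_def)

lemma keys_squarefree_exponent: "finite F \<Longrightarrow> Poly_Mapping.keys (squarefree_exponent F) = F"
  by (auto simp: in_keys_iff lookup_squarefree_exponent split: if_splits)

lemma keys_squarefree_monom:
  "Poly_Mapping.keys (squarefree_monom F :: ('v, 'k::field) mpoly) = {squarefree_exponent F}"
  by (simp add: squarefree_monom_eq)

lemma squarefree_exponent_Un:
  assumes "finite F" "finite G" "F \<inter> G = {}"
  shows "squarefree_exponent (F \<union> G) = squarefree_exponent F + squarefree_exponent G"
  using assms by (simp add: squarefree_exponent_def sum.union_disjoint)

lemma squarefree_monom_Un:
  assumes "finite F" "finite G" "F \<inter> G = {}"
  shows "squarefree_monom (F \<union> G) =
    (squarefree_monom F * squarefree_monom G :: ('v, 'k::field) mpoly)"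
  using squarefree_exponent_Un[OF assms] by (simp add: squarefree_monom_eq mult_single)

lemma keys_add_exponents:
  fixes a b :: "'v \<Rightarrow>\<^sub>0 nat"
  shows "Poly_Mapping.keys (a + b) = Poly_Mapping.keys a \<union> Poly_Mapping.keys b"
  by (auto simp: in_keys_iff lookup_add)

lemma poly_mapping_sum_single:
  fixes p :: "'a \<Rightarrow>\<^sub>0 'b::comm_monoid_add"
  shows "p = (\<Sum>m\<in>Poly_Mapping.keys p. Poly_Mapping.single m (Poly_Mapping.lookup p m))"
  by (rule poly_mapping_eqI)
    (simp add: lookup_sum lookup_single when_def not_in_keys_iff_lookup_eq_zero)

lemma lookup_single_times:
  fixes p :: "('v, 'k::field) mpoly"
  shows "Poly_Mapping.lookup (Poly_Mapping.single a c * p) (a + m) = c * Poly_Mapping.lookup p m"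
proof -
  have "Poly_Mapping.single a c * p =
      (\<Sum>b\<in>Poly_Mapping.keys p. Poly_Mapping.single (a + b) (c * Poly_Mapping.lookup p b))"
    by (subst poly_mapping_sum_single[of p]) (simp add: sum_distrib_left mult_single)
  then show ?thesis
    by (simp add: lookup_sum lookup_single when_def not_in_keys_iff_lookup_eq_zero)
qed

text \<open>
  A polynomial lies in a monomial ideal iff each of its monomials is divisible by a generator.
\<close>

lemma genideal_squarefree_monoms:
  assumes "finite V" and A: "A \<subseteq> Pow V"
  shows "Idl\<^bsub>poly_ring V\<^esub> (squarefree_monom ` A) =
    {p :: ('v, 'k::field) mpoly. p \<in> carrier (poly_ring V) \<and>
       (\<forall>m\<in>Poly_Mapping.keys p. \<exists>F\<in>A. F \<subseteq> Poly_Mapping.keys m)}" (is "_ = ?J")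
proof
  interpret R: cring "poly_ring V :: ('v, 'k) mpoly ring" by (rule poly_ring_cring)
  have sub: "F \<subseteq> V" and fin: "finite F" if "F \<in> A" for F
    using that assms by (auto intro: finite_subset)
  have gens: "squarefree_monom ` A \<subseteq> ?J"
    using subsetD[OF sub] fin
    by (auto simp: carrier_poly_ring_iff keys_squarefree_monom keys_squarefree_exponent)
  have "ideal ?J (poly_ring V)"
  proof (rule ideal_poly_ringI)
    show "p + q \<in> ?J" if "p \<in> ?J" "q \<in> ?J" for p q
      using that Poly_Mapping.keys_add[of p q] by (auto simp: poly_ring_closed)
  next
    fix p q :: "('v, 'k) mpoly"
    assume p: "p \<in> carrier (poly_ring V)" and q: "q \<in> ?J"
    have "\<exists>F\<in>A. F \<subseteq> Poly_Mapping.keys m" if m: "m \<in> Poly_Mapping.keys (p * q)" for m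
    proof -
      obtain a b where "m = a + b" "b \<in> Poly_Mapping.keys q"
        using m keys_mult[of p q] by blast
      moreover from this obtain F where "F \<in> A" "F \<subseteq> Poly_Mapping.keys b"
        using q by blast
      ultimately show ?thesis by (auto simp: keys_add_exponents intro!: bexI[of _ F])
    qed
    then show "p * q \<in> ?J" using p q by (auto simp: poly_ring_closed)
  qed (auto simp: poly_ring_closed)
  then show "Idl\<^bsub>poly_ring V\<^esub> (squarefree_monom ` A) \<subseteq> ?J"
    using gens by (rule R.genideal_minimal)
  have gens_carr: "squarefree_monom ` A \<subseteq> carrier (poly_ring V :: ('v, 'k) mpoly ring)"
    using gens by blast
  have ideal: "ideal (Idl\<^bsub>poly_ring V\<^esub> (squarefree_monom ` A :: ('v, 'k) mpoly set)) (poly_ring V)"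
    using gens_carr by (rule R.genideal_ideal)
  show "?J \<subseteq> Idl\<^bsub>poly_ring V\<^esub> (squarefree_monom ` A)"
  proof
    fix p assume p: "p \<in> ?J"
    have "Poly_Mapping.single m (Poly_Mapping.lookup p m) \<in>
        Idl\<^bsub>poly_ring V\<^esub> (squarefree_monom ` A)" if m: "m \<in> Poly_Mapping.keys p" for m
    proof -
      obtain F where F: "F \<in> A" "F \<subseteq> Poly_Mapping.keys m" using p m by blast
      let ?u = "m - squarefree_exponent F"
      have u: "m = ?u + squarefree_exponent F"
      proof (rule poly_mapping_eqI)
        fix v
        have "v \<in> F \<Longrightarrow> 0 < Poly_Mapping.lookup m v"
          using F(2) by (auto simp: in_keys_iff)
        then show "Poly_Mapping.lookup m v =
            Poly_Mapping.lookup (?u + squarefree_exponent F) v"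
          using fin[OF F(1)] by (simp add: lookup_add lookup_minus lookup_squarefree_exponent)
      qed
      have "Poly_Mapping.keys m \<subseteq> V" using p m by (auto simp: carrier_poly_ring_iff)
      then have "Poly_Mapping.keys ?u \<subseteq> V"
        by (subst (asm) u) (simp add: keys_add_exponents)
      then have "Poly_Mapping.single ?u (Poly_Mapping.lookup p m) \<in> carrier (poly_ring V)"
        by (simp add: carrier_poly_ring_iff)
      moreover have "squarefree_monom F \<in>
          Idl\<^bsub>poly_ring V\<^esub> (squarefree_monom ` A :: ('v, 'k) mpoly set)"
        using R.genideal_self[OF gens_carr] F(1) by blast
      ultimately have "Poly_Mapping.single ?u (Poly_Mapping.lookup p m) * squarefree_monom F \<in>
          Idl\<^bsub>poly_ring V\<^esub> (squarefree_monom ` A)"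
        by (rule ideal_poly_ringD(4)[OF ideal])
      then show ?thesis
        using u by (simp add: squarefree_monom_eq mult_single)
    qed
    then have "(\<Sum>m\<in>Poly_Mapping.keys p. Poly_Mapping.single m (Poly_Mapping.lookup p m)) \<in>
        Idl\<^bsub>poly_ring V\<^esub> (squarefree_monom ` A)"
      by (intro ideal_poly_ringD(5)[OF ideal]) auto
    then show "p \<in> Idl\<^bsub>poly_ring V\<^esub> (squarefree_monom ` A)"
      using poly_mapping_sum_single[of p] by simp
  qed
qed


section \<open>Complete intersection complexes\<close>

lemma simplicial_complexD:
  assumes "simplicial_complex V \<Delta>"
  shows "finite V" and "{} \<in> \<Delta>" and "\<And>F. F \<in> \<Delta> \<Longrightarrow> F \<subseteq> V"
    and "\<And>v. v \<in> V \<Longrightarrow> {v} \<in> \<Delta>"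
    and "\<And>F G. F \<in> \<Delta> \<Longrightarrow> G \<subseteq> F \<Longrightarrow> G \<in> \<Delta>"
proof -
  have *: "finite V" "\<Delta> \<noteq> {}" "\<Delta> \<subseteq> Pow V" "\<forall>v\<in>V. {v} \<in> \<Delta>"
    "\<forall>F\<in>\<Delta>. \<forall>G. G \<subseteq> F \<longrightarrow> G \<in> \<Delta>"
    using assms by (simp_all add: simplicial_complex_def)
  show "finite V" by (fact *)
  show down: "G \<in> \<Delta>" if "F \<in> \<Delta>" "G \<subseteq> F" for F G
    using *(5) that by simp
  obtain F where "F \<in> \<Delta>" using *(2) by blast
  then show "{} \<in> \<Delta>" by (rule down) simp
  show "F \<subseteq> V" if "F \<in> \<Delta>" for F
    using *(3) that by blast
  show "{v} \<in> \<Delta>" if "v \<in> V" for v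
    using *(4) that by simp
qed

text \<open>
  The minimal nonfaces are the supports of the minimal monomial generators of the
  Stanley--Reisner ideal.
\<close>

definition minimal_nonfaces :: "'v set \<Rightarrow> 'v set set \<Rightarrow> 'v set set" where
  "minimal_nonfaces V \<Delta> = {F. F \<subseteq> V \<and> F \<notin> \<Delta> \<and> (\<forall>G. G \<subset> F \<longrightarrow> G \<in> \<Delta>)}"

lemma minimal_nonfacesD:
  assumes "F \<in> minimal_nonfaces V \<Delta>"
  shows "F \<subseteq> V" and "F \<notin> \<Delta>" and "\<And>G. G \<subset> F \<Longrightarrow> G \<in> \<Delta>"
  using assms by (simp_all add: minimal_nonfaces_def)

lemma nonface_contains_minimal:
  assumes "finite V" "F \<subseteq> V" "F \<notin> \<Delta>"
  shows "\<exists>G\<in>minimal_nonfaces V \<Delta>. G \<subseteq> F"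
proof -
  have "finite F" using assms(1,2) by (rule rev_finite_subset)
  then show ?thesis using assms(2,3)
  proof (induction F rule: finite_psubset_induct)
    case (psubset F)
    show ?case
    proof (cases "\<exists>G. G \<subset> F \<and> G \<notin> \<Delta>")
      case True
      then obtain G where G: "G \<subset> F" "G \<notin> \<Delta>" by (elim exE conjE)
      then have "G \<subseteq> F" "G \<subseteq> V" using psubset.prems(1)
        by (simp_all add: psubset_eq subset_trans[of G F V])
      then obtain H where "H \<in> minimal_nonfaces V \<Delta>" "H \<subseteq> G"
        using psubset.IH[OF G(1) \<open>G \<subseteq> V\<close> G(2)] by (elim bexE)
      then show ?thesis using \<open>G \<subseteq> F\<close> by (intro bexI[of _ H]) simp_all
    next
      case False
      then show ?thesis
        using psubset.prems by (intro bexI[of _ F]) (simp_all add: minimal_nonfaces_def)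
    qed
  qed
qed

lemma stanley_reisner_ideal_eq:
  assumes "finite V"
  shows "stanley_reisner_ideal V \<Delta> =
    {p :: ('v, 'k::field) mpoly. p \<in> carrier (poly_ring V) \<and>
       (\<forall>m\<in>Poly_Mapping.keys p. \<exists>F. F \<subseteq> V \<and> F \<notin> \<Delta> \<and> F \<subseteq> Poly_Mapping.keys m)}"
  unfolding stanley_reisner_ideal_def
  by (subst genideal_squarefree_monoms[OF assms]) (simp_all add: Bex_def conj_assoc subset_iff)

lemma stanley_reisner_ideal_minimal:
  assumes "finite V"
  shows "stanley_reisner_ideal V \<Delta> =
    Idl\<^bsub>poly_ring V\<^esub> (squarefree_monom ` minimal_nonfaces V \<Delta> :: ('v, 'k::field) mpoly set)"
proof -
  have "(\<exists>F. F \<subseteq> V \<and> F \<notin> \<Delta> \<and> F \<subseteq> X) \<longleftrightarrow> (\<exists>F\<in>minimal_nonfaces V \<Delta>. F \<subseteq> X)" for X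
  proof
    assume "\<exists>F. F \<subseteq> V \<and> F \<notin> \<Delta> \<and> F \<subseteq> X"
    then obtain F where F: "F \<subseteq> V" "F \<notin> \<Delta>" "F \<subseteq> X" by (elim exE conjE)
    obtain G where "G \<in> minimal_nonfaces V \<Delta>" "G \<subseteq> F"
      using nonface_contains_minimal[OF assms F(1,2)] by (elim bexE)
    then show "\<exists>G\<in>minimal_nonfaces V \<Delta>. G \<subseteq> X"
      using F(3) by (intro bexI[of _ G]) simp_all
  next
    assume "\<exists>F\<in>minimal_nonfaces V \<Delta>. F \<subseteq> X"
    then obtain F where F: "F \<in> minimal_nonfaces V \<Delta>" "F \<subseteq> X" by (elim bexE)
    show "\<exists>F. F \<subseteq> V \<and> F \<notin> \<Delta> \<and> F \<subseteq> X"
      using F(2) minimal_nonfacesD(1,2)[OF F(1)] by (intro exI[of _ F] conjI)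
  qed
  moreover have "minimal_nonfaces V \<Delta> \<subseteq> Pow V" by (auto simp: minimal_nonfaces_def)
  ultimately show ?thesis
    by (simp add: stanley_reisner_ideal_eq[OF assms] genideal_squarefree_monoms[OF assms])
qed

text \<open>
  Let \<open>I\<close> be the Stanley--Reisner ideal, generated by a regular sequence \<open>f\<^sub>1, \<dots>, f\<^sub>r\<close>, and
  suppose that two minimal nonfaces \<open>F \<noteq> G\<close> meet. Write \<open>x\<^sup>F = \<Sum> c\<^sub>i f\<^sub>i\<close> and
  \<open>x\<^sup>G = \<Sum> d\<^sub>i f\<^sub>i\<close>. Both \<open>x\<^sup>F\<close> times the monomial of \<open>G - F\<close> and \<open>x\<^sup>G\<close> times the monomial of
  \<open>F - G\<close> equal the monomial of \<open>F \<union> G\<close>, which gives a syzygy of the \<open>f\<^sub>i\<close> whose coefficients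
  must lie in \<open>I\<close>. As \<open>G - F\<close> is a proper subset of \<open>G\<close>, it is a face, so its monomial does not
  occur in these coefficients; this forces the constant term of every \<open>c\<^sub>i\<close> to vanish. Then
  \<open>x\<^sup>F\<close> is a combination of elements of \<open>I\<close> with coefficients in the irrelevant maximal ideal,
  which contradicts the minimality of \<open>F\<close>.
\<close>

lemma complete_intersection_imp_disjoint:
  fixes V :: "'v set"
  assumes complex: "simplicial_complex V \<Delta>"
    and ci: "complete_intersection_complex TYPE('k::field) V \<Delta>"
  shows "pairwise disjnt (minimal_nonfaces V \<Delta>)"
proof (rule pairwiseI, rule ccontr)
  fix F G
  assume F: "F \<in> minimal_nonfaces V \<Delta>" and G: "G \<in> minimal_nonfaces V \<Delta>"
    and neq: "F \<noteq> G" and meet: "\<not> disjnt F G"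
  note finV = simplicial_complexD(1)[OF complex] and down = simplicial_complexD(5)[OF complex]
  note FG = minimal_nonfacesD(1,2)[OF F] minimal_nonfacesD(1,2)[OF G]
    and minF = minimal_nonfacesD(3)[OF F] and minG = minimal_nonfacesD(3)[OF G]
  have fin: "finite F" "finite G"
    using finite_subset[OF FG(1) finV] finite_subset[OF FG(3) finV] by simp_all
  let ?I = "stanley_reisner_ideal V \<Delta> :: ('v, 'k) mpoly set"
  let ?u = "squarefree_monom (G - F) :: ('v, 'k) mpoly"
  let ?v = "squarefree_monom (F - G) :: ('v, 'k) mpoly"
  obtain fs :: "('v, 'k) mpoly list" where reg: "regular_sequence (poly_ring V) fs"
    and I: "?I = Idl\<^bsub>poly_ring V\<^esub> (set fs)"
    using ci by (auto simp: complete_intersection_complex_def)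
  have fs: "set fs \<subseteq> carrier (poly_ring V)"
    using reg by (simp add: regular_sequence_def)
  interpret R: cring "poly_ring V :: ('v, 'k) mpoly ring" by (rule poly_ring_cring)
  have fsI: "set fs \<subseteq> ?I" unfolding I using fs by (rule R.genideal_self)
  have mem: "squarefree_monom H \<in> ?I" if "H \<subseteq> V" "H \<notin> \<Delta>" for H
    using that finite_subset[OF that(1) finV]
    by (auto simp: stanley_reisner_ideal_eq[OF finV] carrier_poly_ring_iff
        keys_squarefree_monom keys_squarefree_exponent)
  obtain c where c: "squarefree_monom F = (\<Sum>i<length fs. c i * fs ! i)"
    "\<forall>i. c i \<in> carrier (poly_ring V)"
    using mem[OF FG(1,2)] unfolding I genideal_list_eq[OF fs] by blast
  obtain d where d: "squarefree_monom G = (\<Sum>i<length fs. d i * fs ! i)"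
    "\<forall>i. d i \<in> carrier (poly_ring V)"
    using mem[OF FG(3,4)] unfolding I genideal_list_eq[OF fs] by blast
  have uv_carr: "?u \<in> carrier (poly_ring V)" "?v \<in> carrier (poly_ring V)"
    using FG fin by (auto simp: carrier_poly_ring_iff keys_squarefree_monom keys_squarefree_exponent)
  have "?u * squarefree_monom F = ?v * squarefree_monom G"
    using squarefree_monom_Un[of "G - F" F, where 'k = 'k]
      squarefree_monom_Un[of "F - G" G, where 'k = 'k] fin
    by (simp add: Un_commute Diff_Int_distrib2)
  then have syz: "(\<Sum>i<length fs. (?u * c i - ?v * d i) * fs ! i) = 0"
    by (simp add: c(1) d(1) sum_distrib_left algebra_simps sum_subtractf)
  have coeff0: "Poly_Mapping.lookup (c i) 0 = 0" if "i < length fs" for i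
  proof (rule ccontr)
    assume nz: "Poly_Mapping.lookup (c i) 0 \<noteq> 0"
    have "?u * c i - ?v * d i \<in> Idl\<^bsub>poly_ring V\<^esub> (set (take (length fs) fs))"
      using syz that c(2) d(2) uv_carr
      by (intro regular_sequence_syzygy[OF reg, where a = "\<lambda>i. ?u * c i - ?v * d i"])
        (auto intro!: poly_ring_closed)
    then have inI: "?u * c i - ?v * d i \<in> ?I" by (simp add: I)
    have "squarefree_exponent (G - F) \<notin> Poly_Mapping.keys (?v * d i)"
    proof
      assume "squarefree_exponent (G - F) \<in> Poly_Mapping.keys (?v * d i)"
      then obtain b where "squarefree_exponent (G - F) = squarefree_exponent (F - G) + b"
        using keys_mult[of ?v "d i"] by (auto simp: keys_squarefree_monom)
      then have "Poly_Mapping.keys (squarefree_exponent (G - F)) =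
          Poly_Mapping.keys (squarefree_exponent (F - G)) \<union> Poly_Mapping.keys b"
        by (simp add: keys_add_exponents)
      then have "F - G \<subseteq> G - F" using fin by (simp add: keys_squarefree_exponent)
      then have "F \<subset> G" using neq by blast
      then show False using minG[of F] FG(2) by simp
    qed
    moreover have "Poly_Mapping.lookup (?u * c i) (squarefree_exponent (G - F)) =
        Poly_Mapping.lookup (c i) 0"
      using lookup_single_times[of "squarefree_exponent (G - F)" 1 "c i" 0]
      by (simp add: squarefree_monom_eq)
    ultimately have "squarefree_exponent (G - F) \<in> Poly_Mapping.keys (?u * c i - ?v * d i)"
      using nz by (simp add: in_keys_iff lookup_minus)
    then obtain H where "H \<notin> \<Delta>" "H \<subseteq> Poly_Mapping.keys (squarefree_exponent (G - F))"
      using inI by (auto simp: stanley_reisner_ideal_eq[OF finV])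
    then have "H \<notin> \<Delta>" "H \<subseteq> G - F" using fin by (simp_all add: keys_squarefree_exponent)
    moreover have "G - F \<in> \<Delta>" using meet by (intro minG) (auto simp: disjnt_def)
    ultimately show False using down[of "G - F" H] by simp
  qed
  have "squarefree_exponent F \<in> Poly_Mapping.keys (\<Sum>i<length fs. c i * fs ! i)"
    unfolding c(1)[symmetric] by (simp add: keys_squarefree_monom)
  then obtain i where i: "i < length fs" "squarefree_exponent F \<in> Poly_Mapping.keys (c i * fs ! i)"
    using keys_sum[of "\<lambda>i. c i * fs ! i" "{..<length fs}"] by auto
  then obtain a b where ab: "squarefree_exponent F = a + b"
    "a \<in> Poly_Mapping.keys (c i)" "b \<in> Poly_Mapping.keys (fs ! i)"
    using keys_mult[of "c i" "fs ! i"] by auto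
  have "fs ! i \<in> ?I" using fsI i(1) by auto
  then obtain H where H: "H \<notin> \<Delta>" "H \<subseteq> Poly_Mapping.keys b"
    using ab(3) by (auto simp: stanley_reisner_ideal_eq[OF finV])
  have "Poly_Mapping.keys b \<subseteq> F"
    using keys_add_exponents[of a b] fin by (simp add: ab(1)[symmetric] keys_squarefree_exponent)
  \<comment> \<open>The factor \<open>b\<close> involves every variable of \<open>F\<close>, so it is all of \<open>x\<^sup>F\<close> and \<open>a\<close> is constant.\<close>
  then have keys_b: "Poly_Mapping.keys b = F" using H minF by blast
  have "a = 0"
  proof (rule poly_mapping_eqI)
    fix v
    have "Poly_Mapping.lookup a v + Poly_Mapping.lookup b v = (if v \<in> F then 1 else 0)"
      using fin ab(1) by (metis lookup_add lookup_squarefree_exponent)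
    moreover have "v \<in> F \<Longrightarrow> Poly_Mapping.lookup b v > 0"
      using keys_b by (auto simp: in_keys_iff)
    ultimately show "Poly_Mapping.lookup a v = Poly_Mapping.lookup 0 v"
      by (simp split: if_splits)
  qed
  then show False using ab(2) coeff0[OF i(1)] by (simp add: in_keys_iff)
qed

text \<open>
  Conversely, squarefree monomials with pairwise disjoint supports form a regular sequence in any
  order, since multiplying a monomial \<open>m\<close> by one of them does not affect divisibility of \<open>m\<close> by the
  others.
\<close>

lemma disjoint_imp_complete_intersection:
  fixes V :: "'v set"
  assumes complex: "simplicial_complex V \<Delta>"
    and disj: "pairwise disjnt (minimal_nonfaces V \<Delta>)"
  shows "complete_intersection_complex TYPE('k::field) V \<Delta>"
proof -
  note finV = simplicial_complexD(1)[OF complex] and empty = simplicial_complexD(2)[OF complex]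
  have sub: "minimal_nonfaces V \<Delta> \<subseteq> Pow V" by (auto simp: minimal_nonfaces_def)
  have "finite (minimal_nonfaces V \<Delta>)"
    using sub by (rule finite_subset) (simp add: finV)
  have fin: "finite F" if "F \<in> minimal_nonfaces V \<Delta>" for F
    using finite_subset[OF minimal_nonfacesD(1)[OF that] finV] .
  obtain Fs where Fs: "set Fs = minimal_nonfaces V \<Delta>" "distinct Fs"
    using finite_distinct_list[OF \<open>finite (minimal_nonfaces V \<Delta>)\<close>] by blast
  let ?fs = "map squarefree_monom Fs :: ('v, 'k) mpoly list"
  have Idl: "Idl\<^bsub>poly_ring V\<^esub> (set (take i ?fs)) =
      {p. p \<in> carrier (poly_ring V) \<and>
         (\<forall>m\<in>Poly_Mapping.keys p. \<exists>F\<in>set (take i Fs). F \<subseteq> Poly_Mapping.keys m)}" for i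
    using Fs sub set_take_subset[of i Fs]
    by (simp add: take_map genideal_squarefree_monoms[OF finV, symmetric])
  have "regular_sequence (poly_ring V) ?fs"
    unfolding regular_sequence_def
  proof (intro conjI allI impI ballI)
    show "set ?fs \<subseteq> carrier (poly_ring V)"
      using Fs(1) sub fin
      by (auto simp: carrier_poly_ring_iff keys_squarefree_monom keys_squarefree_exponent)
  next
    have "{} \<notin> set Fs" using Fs empty by (auto simp: minimal_nonfaces_def)
    then have "1 \<notin> Idl\<^bsub>poly_ring V\<^esub> (set ?fs)"
      using Idl[of "length Fs"] by auto
    then show "Idl\<^bsub>poly_ring V\<^esub> (set ?fs) \<noteq> carrier (poly_ring V)"
      using poly_ring_closed(2) by blast
  next
    fix i g
    assume i: "i < length ?fs" and g: "g \<in> carrier (poly_ring V)"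
      and mult: "?fs ! i \<otimes>\<^bsub>poly_ring V\<^esub> g \<in> Idl\<^bsub>poly_ring V\<^esub> (set (take i ?fs))"
    have finFi: "finite (Fs ! i)"
      using i Fs(1) nth_mem[of i Fs] by (intro fin) simp
    have "\<exists>F\<in>set (take i Fs). F \<subseteq> Poly_Mapping.keys m" if m: "m \<in> Poly_Mapping.keys g" for m
    proof -
      have "squarefree_exponent (Fs ! i) + m \<in> Poly_Mapping.keys (squarefree_monom (Fs ! i) * g)"
        using m by (simp add: in_keys_iff squarefree_monom_eq lookup_single_times)
      then obtain F where F: "F \<in> set (take i Fs)"
        "F \<subseteq> Poly_Mapping.keys (squarefree_exponent (Fs ! i) + m)"
        using mult i by (auto simp: Idl poly_ring_simps)
      then have "F \<subseteq> Fs ! i \<union> Poly_Mapping.keys m"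
        by (simp add: keys_add_exponents keys_squarefree_exponent finFi)
      moreover have "F \<noteq> Fs ! i"
        using F(1) Fs(2) i by (auto simp: in_set_conv_nth nth_eq_iff_index_eq)
      then have "disjnt F (Fs ! i)"
        using disj F(1) Fs(1) i set_take_subset[of i Fs] nth_mem[of i Fs]
        by (auto simp: pairwise_def)
      ultimately show ?thesis using F(1) by (auto simp: disjnt_def)
    qed
    then show "g \<in> Idl\<^bsub>poly_ring V\<^esub> (set (take i ?fs))"
      using g by (simp add: Idl)
  qed
  moreover have "stanley_reisner_ideal V \<Delta> = Idl\<^bsub>poly_ring V\<^esub> (set ?fs)"
    using stanley_reisner_ideal_minimal[OF finV] Fs(1) by simp
  ultimately show ?thesis
    unfolding complete_intersection_complex_def by blast
qed


section \<open>Minimal nonfaces of a complex and of its vertex links\<close>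

text \<open>
  Connected complexes in which every vertex link has pairwise disjoint minimal nonfaces. This is
  the combinatorial content of being a locally complete intersection complex; the field no longer
  appears.
\<close>

locale locally_disjoint_complex =
  fixes V :: "'v set" and \<Delta> :: "'v set set"
  assumes complex: "simplicial_complex V \<Delta>"
    and connected: "connected_complex V \<Delta>"
    and link_disjoint: "v \<in> V \<Longrightarrow>
      pairwise disjnt (minimal_nonfaces (vertices (link \<Delta> {v})) (link \<Delta> {v}))"
begin

text \<open>
  Adjacency in the 1-skeleton.
\<close>

definition adj :: "'v \<Rightarrow> 'v \<Rightarrow> bool" where
  "adj x y \<longleftrightarrow> x \<noteq> y \<and> {x, y} \<in> \<Delta>"

lemmas down = simplicial_complexD(5)[OF complex]
lemmas face_sub = simplicial_complexD(3)[OF complex]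

lemma finite_complex: "finite \<Delta>"
proof (rule finite_subset)
  show "\<Delta> \<subseteq> Pow V" using face_sub by auto
qed (simp add: simplicial_complexD(1)[OF complex])

lemma adj_sym: "adj x y \<Longrightarrow> adj y x"
  by (auto simp: adj_def insert_commute)

lemma adj_irrefl: "\<not> adj x x"
  by (simp add: adj_def)

lemma adj_in_V: "adj x y \<Longrightarrow> x \<in> V" "adj x y \<Longrightarrow> y \<in> V"
  using face_sub[of "{x, y}"] by (simp_all add: adj_def)

lemma adj_of_face: "F \<in> \<Delta> \<Longrightarrow> x \<in> F \<Longrightarrow> y \<in> F \<Longrightarrow> x \<noteq> y \<Longrightarrow> adj x y"
  using down[of F "{x, y}"] by (simp add: adj_def)

lemma connected_induct [consumes 2, case_names base step]:
  assumes "u \<in> V" "v \<in> V" "P u"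
    and "\<And>x y. P x \<Longrightarrow> adj x y \<Longrightarrow> P y"
  shows "P v"
proof -
  have "(u, v) \<in> {(x, y). x \<noteq> y \<and> {x, y} \<in> \<Delta>}\<^sup>*"
    using connected assms(1,2) by (simp add: connected_complex_def)
  then show ?thesis
    by (induction rule: rtrancl_induct) (use assms(3,4) in \<open>auto simp: adj_def\<close>)
qed

lemma link_iff: "G \<in> link \<Delta> {v} \<longleftrightarrow> v \<notin> G \<and> insert v G \<in> \<Delta>"
  using down[of "insert v G" G] by (auto simp: link_def)

lemma vertices_link: "vertices (link \<Delta> {v}) = {w. adj v w}"
  by (auto simp: vertices_def link_iff adj_def)

lemma link_disjointD:
  assumes "v \<in> V"
    and "F \<in> minimal_nonfaces (vertices (link \<Delta> {v})) (link \<Delta> {v})"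
    and "G \<in> minimal_nonfaces (vertices (link \<Delta> {v})) (link \<Delta> {v})"
    and "x \<in> F" "x \<in> G"
  shows "F = G"
proof (rule ccontr)
  assume "F \<noteq> G"
  then have "disjnt F G" using pairwiseD[OF link_disjoint[OF assms(1)] assms(2,3)] by simp
  then show False using assms(4,5) by (auto simp: disjnt_iff)
qed

text \<open>
  Two kinds of minimal nonfaces of the link of \<open>v\<close> are used throughout: pairs of neighbours of \<open>v\<close>
  that do not span a triangle with \<open>v\<close>, and the sets \<open>F - {v}\<close> for minimal nonfaces \<open>F\<close> of the
  complex that contain \<open>v\<close> and have at least three elements.
\<close>

lemma pair_minimal_nonface_link:
  assumes "adj v x" "adj v y" "x \<noteq> y" "{v, x, y} \<notin> \<Delta>"
  shows "{x, y} \<in> minimal_nonfaces (vertices (link \<Delta> {v})) (link \<Delta> {v})"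
proof -
  have "G \<in> link \<Delta> {v}" if "G \<subset> {x, y}" for G
  proof -
    have "G = {} \<or> G = {x} \<or> G = {y}" using that by auto
    moreover have "{v} \<in> \<Delta>" using down[of "{v, x}" "{v}"] assms(1) by (simp add: adj_def)
    ultimately show ?thesis using assms(1,2) by (auto simp: link_iff adj_def)
  qed
  then show ?thesis
    using assms by (simp add: minimal_nonfaces_def vertices_link link_iff)
qed

text \<open>
  In the link of \<open>v\<close> the pairs that are not edges form a matching.
\<close>

lemma triangle_alternative:
  assumes "adj v x" "adj v y" "adj v z" "x \<noteq> y" "x \<noteq> z" "y \<noteq> z"
  shows "{v, x, y} \<in> \<Delta> \<or> {v, x, z} \<in> \<Delta>"
proof (rule ccontr)
  assume "\<not> ?thesis"
  then have "{x, y} \<in> minimal_nonfaces (vertices (link \<Delta> {v})) (link \<Delta> {v})"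
    "{x, z} \<in> minimal_nonfaces (vertices (link \<Delta> {v})) (link \<Delta> {v})"
    using assms by (auto intro: pair_minimal_nonface_link)
  then have "{x, y} = {x, z}"
    using link_disjointD[OF adj_in_V(1)[OF assms(1)]] by blast
  then show False using assms(4-6) by (simp add: doubleton_eq_iff)
qed

lemma adj_alternative:
  assumes "adj v x" "adj v y" "adj v z" "x \<noteq> y" "x \<noteq> z" "y \<noteq> z"
  shows "adj x y \<or> adj x z"
  using triangle_alternative[OF assms] adj_of_face[of "{v, x, y}" x y] adj_of_face[of "{v, x, z}" x z]
    assms(4,5) by auto

abbreviation "MN \<equiv> minimal_nonfaces V \<Delta>"

lemma minimal_nonface_finite: "F \<in> MN \<Longrightarrow> finite F"
  using minimal_nonfacesD(1) simplicial_complexD(1)[OF complex] by (rule finite_subset)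

lemma minimal_nonface_card:
  assumes "F \<in> MN"
  shows "card F \<ge> 2"
proof (rule ccontr)
  assume "\<not> 2 \<le> card F"
  then have "card F = 0 \<or> card F = 1" by linarith
  then have "F = {} \<or> (\<exists>v. F = {v})"
    using minimal_nonface_finite[OF assms] by (auto simp: card_1_singleton_iff)
  then show False
    using minimal_nonfacesD(1,2)[OF assms] simplicial_complexD(2,4)[OF complex] by auto
qed

lemma adj_in_large_nonface:
  assumes F: "F \<in> MN" and card: "card F \<ge> 3" and "x \<in> F" "y \<in> F" "x \<noteq> y"
  shows "adj x y"
proof -
  have "{x, y} \<noteq> F" using card assms(5) by auto
  then have "{x, y} \<in> \<Delta>" using assms by (intro minimal_nonfacesD(3)[OF F]) auto
  then show ?thesis using assms(5) by (simp add: adj_def)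
qed

lemma large_nonface_link:
  assumes F: "F \<in> MN" and card: "card F \<ge> 3" and v: "v \<in> F"
  shows "F - {v} \<in> minimal_nonfaces (vertices (link \<Delta> {v})) (link \<Delta> {v})"
proof -
  have "F - {v} \<subseteq> vertices (link \<Delta> {v})"
    using adj_in_large_nonface[OF F card v] by (auto simp: vertices_link)
  moreover have "F - {v} \<notin> link \<Delta> {v}"
    using minimal_nonfacesD(2)[OF F] v by (simp add: link_iff insert_absorb)
  moreover have "G \<in> link \<Delta> {v}" if G: "G \<subset> F - {v}" for G
  proof -
    have "insert v G \<subset> F" using G v by auto
    then have "insert v G \<in> \<Delta>" by (rule minimal_nonfacesD(3)[OF F])
    then show ?thesis using G by (auto simp: link_iff)
  qed
  ultimately show ?thesis by (simp add: minimal_nonfaces_def)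
qed

lemma adj_large_nonface_all:
  assumes F: "F \<in> MN" and card: "card F \<ge> 3" and x: "x \<in> F" and y: "y \<notin> F" "adj x y"
    and z: "z \<in> F"
  shows "adj y z"
proof (rule ccontr)
  assume no: "\<not> adj y z"
  then have "z \<noteq> x" using y adj_sym by blast
  then have xz: "adj x z" using adj_in_large_nonface[OF F card x z] by simp
  have "y \<noteq> z" using y(1) z by auto
  have "{x, y, z} \<notin> \<Delta>" using no \<open>y \<noteq> z\<close> adj_of_face[of "{x, y, z}" y z] by auto
  then have "{y, z} \<in> minimal_nonfaces (vertices (link \<Delta> {x})) (link \<Delta> {x})"
    using y xz \<open>y \<noteq> z\<close> by (intro pair_minimal_nonface_link)
  \<comment> \<open>Two minimal nonfaces of the link of \<open>x\<close> that share \<open>z\<close>.\<close>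
  then have "{y, z} = F - {x}"
    using link_disjointD[OF adj_in_V(1)[OF y(2)] _ large_nonface_link[OF F card x], of "{y, z}" z]
      z \<open>z \<noteq> x\<close> by simp
  then show False using y(1) by auto
qed

text \<open>
  By connectedness the alternative in \<open>adj_large_nonface_all\<close> propagates from \<open>F\<close> to all vertices:
  if \<open>u\<close> is adjacent to all of \<open>F\<close> and \<open>w\<close> is a neighbour of \<open>u\<close>, then \<open>w\<close> cannot miss two
  elements of \<open>F\<close>, by the matching property in the link of \<open>u\<close>.
\<close>

lemma large_nonface_dominates:
  assumes F: "F \<in> MN" and card: "card F \<ge> 3" and v: "v \<in> V" "v \<notin> F" and z: "z \<in> F"
  shows "adj v z"
proof -
  obtain g where g: "g \<in> F" "g \<noteq> z"
    using card z by (metis card_le_Suc0_iff_eq minimal_nonface_finite[OF F] One_nat_def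
        not_less_eq_eq numeral_3_eq_3 Suc_leD)
  have "z \<in> V" using minimal_nonfacesD(1)[OF F] z by blast
  then have "v \<in> F \<or> (\<forall>z\<in>F. adj v z)" using v(1)
  proof (induction rule: connected_induct)
    case base
    show ?case using z by simp
  next
    case (step u w)
    show ?case
    proof (cases "w \<in> F")
      case True
      then show ?thesis by simp
    next
      case w: False
      obtain x where "x \<in> F" "adj x w"
      proof (cases "u \<in> F")
        case True
        then show ?thesis using step(2) that by blast
      next
        case False
        then have all: "\<forall>z\<in>F. adj u z" using step(1) by blast
        then have "adj w g \<or> adj w z"
          using g z w step(2) by (intro adj_alternative[of u]) auto
        then show ?thesis using g z that adj_sym by blast
      qed
      then show ?thesis
        using adj_large_nonface_all[OF F card _ w] by blast
    qed
  qed
  then show ?thesis using v(2) z by simp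
qed

lemma large_nonfaces_share_at_most_one:
  assumes F: "F \<in> MN" "card F \<ge> 3" and G: "G \<in> MN" "card G \<ge> 3"
    and "x \<in> F" "x \<in> G" "y \<in> F" "y \<in> G" "x \<noteq> y"
  shows "F = G"
proof -
  have "x \<in> V" using minimal_nonfacesD(1)[OF F(1)] \<open>x \<in> F\<close> by blast
  then have "F - {x} = G - {x}"
    using assms by (intro link_disjointD[of x _ _ y] large_nonface_link) auto
  then show ?thesis using assms by blast
qed

text \<open>
  Choose \<open>y \<in> F - G\<close>. The elements of \<open>G\<close> are vertices of the link of \<open>y\<close>, and \<open>G\<close> is a
  nonface there, so it contains a minimal nonface \<open>H\<close> of that link. If \<open>H = G\<close>, then it meets the minimal nonface \<open>F - {y}\<close> of the
  same link in \<open>x\<close>. Otherwise \<open>insert y H\<close> is a minimal nonface of the whole complex sharing two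
  elements with \<open>G\<close>, contrary to \<open>large_nonfaces_share_at_most_one\<close>.
\<close>

lemma large_nonfaces_disjoint:
  assumes F: "F \<in> MN" "card F \<ge> 3" and G: "G \<in> MN" "card G \<ge> 3"
    and x: "x \<in> F" "x \<in> G"
  shows "F = G"
proof (rule ccontr)
  assume neq: "F \<noteq> G"
  have "\<not> F \<subseteq> G"
    using neq minimal_nonfacesD(3)[OF G(1), of F] minimal_nonfacesD(2)[OF F(1)] by blast
  then obtain y where y: "y \<in> F" "y \<notin> G" by blast
  let ?L = "link \<Delta> {y}"
  have yV: "y \<in> V" using y(1) minimal_nonfacesD(1)[OF F(1)] by blast
  have G_sub: "G \<subseteq> vertices ?L"
    using large_nonface_dominates[OF G yV y(2)] by (auto simp: vertices_link)
  have G_non: "insert y G \<notin> \<Delta>" using down[of "insert y G" G] minimal_nonfacesD(2)[OF G(1)] by auto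
  have "finite (vertices ?L)"
    using simplicial_complexD(1)[OF complex] adj_in_V(2)
    by (auto simp: vertices_link intro: finite_subset[of _ V])
  then obtain H where H: "H \<in> minimal_nonfaces (vertices ?L) ?L" "H \<subseteq> G"
    using nonface_contains_minimal[OF _ G_sub, of ?L] G_non by (auto simp: link_iff)
  show False
  proof (cases "H = G")
    case True
    have "x \<in> F - {y}" using x y by auto
    then have "F - {y} = H"
      using link_disjointD[OF yV large_nonface_link[OF F y(1)] H(1)] x(2) True by blast
    then show False
      using True neq minimal_nonfacesD(3)[OF F(1), of G] minimal_nonfacesD(2)[OF G(1)] by blast
  next
    case False
    have yH: "y \<notin> H" using H(2) y(2) by blast
    have H_face: "H \<in> \<Delta>" using False H(2) by (intro minimal_nonfacesD(3)[OF G(1)]) auto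
    have mn: "insert y H \<in> MN"
    proof -
      have "insert y H \<subseteq> V" using yV H(2) minimal_nonfacesD(1)[OF G(1)] by auto
      moreover have "insert y H \<notin> \<Delta>"
        using minimal_nonfacesD(2)[OF H(1)] yH by (simp add: link_iff)
      moreover have "K \<in> \<Delta>" if K: "K \<subset> insert y H" for K
      proof (cases "y \<in> K")
        case True
        then have "K - {y} \<subset> H" using K by auto
        then have "K - {y} \<in> ?L" by (rule minimal_nonfacesD(3)[OF H(1)])
        then show ?thesis using True by (simp add: link_iff insert_absorb)
      next
        case False
        then have "K \<subseteq> H" using K by auto
        then show ?thesis by (rule down[OF H_face])
      qed
      ultimately show ?thesis by (simp add: minimal_nonfaces_def)
    qed
    have "\<not> (\<exists>a. H \<subseteq> {a})"
    proof
      assume "\<exists>a. H \<subseteq> {a}"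
      then have "H = {} \<or> (\<exists>a\<in>vertices ?L. H = {a})"
        using minimal_nonfacesD(1)[OF H(1)] by auto
      then have "insert y H \<in> \<Delta>"
        using simplicial_complexD(4)[OF complex yV] by (auto simp: vertices_link adj_def)
      then show False using minimal_nonfacesD(2)[OF mn] by simp
    qed
    then obtain a b where ab: "a \<in> H" "b \<in> H" "a \<noteq> b" by blast
    have finH: "finite H" using H(2) minimal_nonface_finite[OF G(1)] by (rule finite_subset)
    have "card {a, b} \<le> card H" using ab by (intro card_mono finH) auto
    then have "card (insert y H) \<ge> 3" using finH yH ab(3) by simp
    then have "insert y H = G"
      using mn G H(2) ab by (intro large_nonfaces_share_at_most_one[of _ _ a b]) auto
    then show False using y(2) by blast
  qed
qed

lemma large_small_nonfaces_disjoint: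
  assumes F: "F \<in> MN" "card F \<ge> 3" and G: "G \<in> MN" "card G = 2"
    and x: "x \<in> F" "x \<in> G"
  shows False
proof -
  obtain y where y: "G = {x, y}" "x \<noteq> y"
    using G(2) x(2) by (metis card_2_iff doubleton_eq_iff empty_iff insertE)
  have no: "\<not> adj y x" using minimal_nonfacesD(2)[OF G(1)] y by (auto simp: adj_def insert_commute)
  have "y \<in> V" using minimal_nonfacesD(1)[OF G(1)] y by simp
  moreover have "y \<notin> F"
    using adj_in_large_nonface[OF F, of y x] no x y by auto
  ultimately show False
    using large_nonface_dominates[OF F _ _ x(1)] no by blast
qed

end


section \<open>Complexes of dimension at least two\<close>

text \<open>
  The dimension only matters for pairs of nonedges, as the pentagon shows: it is locally a complete
  intersection, but its minimal nonfaces are its five nonedges, which are not pairwise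
  disjoint. In dimension at least two every vertex lies in a triangle (\<open>vertex_in_triangle\<close>), so two nonadjacent
  neighbours of \<open>v\<close> are always joined by a third one (\<open>third_neighbour\<close>).
\<close>

locale locally_disjoint_complex_dim2 = locally_disjoint_complex V \<Delta>
  for V :: "'v set" and \<Delta> :: "'v set set" +
  assumes dim: "complex_dim \<Delta> \<ge> 2"
begin

lemma exists_triangle: "\<exists>a b c. a \<noteq> b \<and> a \<noteq> c \<and> b \<noteq> c \<and> {a, b, c} \<in> \<Delta>"
proof -
  have "complex_dim \<Delta> \<in> face_dim ` \<Delta>"
    unfolding complex_dim_def using finite_complex simplicial_complexD(2)[OF complex]
    by (intro Max_in) auto
  then obtain F where F: "F \<in> \<Delta>" "3 \<le> card F"
    using dim by (auto simp: face_dim_def)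
  then obtain T where T: "T \<subseteq> F" "card T = 3"
    by (meson obtain_subset_with_card_n)
  then obtain a b c where "T = {a, b, c}" "a \<noteq> b" "b \<noteq> c" "a \<noteq> c"
    by (auto simp: card_3_iff)
  moreover have "T \<in> \<Delta>" using F(1) T(1) by (rule down)
  ultimately show ?thesis by blast
qed

lemma vertex_in_triangle:
  assumes "v \<in> V"
  shows "\<exists>a b. v \<noteq> a \<and> v \<noteq> b \<and> a \<noteq> b \<and> {v, a, b} \<in> \<Delta>"
proof -
  obtain p q r where pqr: "p \<noteq> q" "p \<noteq> r" "q \<noteq> r" "{p, q, r} \<in> \<Delta>"
    using exists_triangle by blast
  have "p \<in> V" using face_sub[OF pqr(4)] by simp
  then show ?thesis using assms
  proof (induction rule: connected_induct)
    case base
    show ?case using pqr by blast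
  next
    case (step v w)
    obtain a b where ab: "v \<noteq> a" "v \<noteq> b" "a \<noteq> b" "{v, a, b} \<in> \<Delta>" using step(1) by blast
    have vw: "v \<noteq> w" using step(2) by (simp add: adj_def)
    show ?case
    proof -
      consider "w = a" | "w = b" | "w \<noteq> a" "w \<noteq> b" by blast
      then have "{w, v, b} \<in> \<Delta> \<and> w \<noteq> b \<or> {w, v, a} \<in> \<Delta> \<and> w \<noteq> a"
      proof cases
        case 1
        then show ?thesis using ab by (simp add: insert_commute)
      next
        case 2
        then show ?thesis using ab by (simp add: insert_commute)
      next
        case 3
        have "adj v a" "adj v b" using ab by (auto intro: adj_of_face)
        then have "{v, w, a} \<in> \<Delta> \<or> {v, w, b} \<in> \<Delta>"
          using 3 step(2) ab(3) by (intro triangle_alternative) auto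
        then show ?thesis using 3 by (auto simp: insert_commute)
      qed
      then show ?thesis
      proof (elim disjE conjE)
        assume "{w, v, b} \<in> \<Delta>" "w \<noteq> b"
        then show ?thesis using vw ab(2) by (intro exI[of _ v] exI[of _ b]) simp
      next
        assume "{w, v, a} \<in> \<Delta>" "w \<noteq> a"
        then show ?thesis using vw ab(1) by (intro exI[of _ v] exI[of _ a]) simp
      qed
    qed
  qed
qed

lemma third_neighbour:
  assumes "adj v x" "adj v y" "x \<noteq> y" "\<not> adj x y"
  shows "\<exists>u. adj v u \<and> adj u x \<and> adj u y"
proof -
  obtain a b where ab: "v \<noteq> a" "v \<noteq> b" "a \<noteq> b" "{v, a, b} \<in> \<Delta>"
    using vertex_in_triangle[OF adj_in_V(1)[OF assms(1)]] by blast
  have adj_ab: "adj v a" "adj v b" "adj a b" "adj b a" using ab by (auto intro: adj_of_face)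
  obtain u where u: "adj v u" "u \<noteq> x" "u \<noteq> y"
  proof (cases "a = x \<or> a = y")
    case True
    then have "b \<noteq> x" "b \<noteq> y" using adj_ab assms(4) ab(3) by auto
    then show ?thesis using adj_ab(2) that by blast
  next
    case False
    then show ?thesis using adj_ab(1) that by blast
  qed
  have "\<not> adj y x" using assms(4) adj_sym by blast
  then have "adj x u" "adj y u"
    using adj_alternative[of v x y u] adj_alternative[of v y x u] assms u by auto
  then show ?thesis using u(1) adj_sym by blast
qed

lemma diameter_two:
  assumes "x \<in> V" "y \<in> V"
  shows "x = y \<or> adj x y \<or> (\<exists>w. adj x w \<and> adj w y)"
  using assms
proof (induction rule: connected_induct)
  case base
  show ?case by simp
next
  case (step w t)
  show ?case
  proof (rule ccontr)
    assume far: "\<not> ?case"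
    have "x \<noteq> w" "\<not> adj x w" using far step(2) by auto
    then obtain v where v: "adj x v" "adj v w" using step(1) by blast
    have vt: "\<not> adj v t" "v \<noteq> t" using far v by auto
    obtain u where u: "adj v u" "adj u x" "adj u w"
      using third_neighbour[of v x w] v \<open>x \<noteq> w\<close> \<open>\<not> adj x w\<close> adj_sym by blast
    have "t \<noteq> u" using far u(2) adj_sym by blast
    moreover have "v \<noteq> u" using u(1) adj_irrefl by auto
    ultimately have "adj t v \<or> adj t u"
      using step(2) v u vt by (intro adj_alternative[of w]) (auto intro: adj_sym)
    then have "adj u t" using vt(1) adj_sym by blast
    then show False using far u(2) adj_sym by blast
  qed
qed

lemma common_neighbour:
  assumes "x \<in> V" "y \<in> V" "x \<noteq> y" "\<not> adj x y"
  obtains w where "adj w x" "adj w y"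
  using diameter_two[OF assms(1,2)] assms(3,4) adj_sym by blast

text \<open>
  If \<open>x\<close> were nonadjacent to two vertices \<open>y\<close> and \<open>z\<close>, then with common neighbours \<open>v\<close> of \<open>x, y\<close>
  and \<open>w\<close> of \<open>x, z\<close> the path \<open>y v x w z\<close> would have no chord, except possibly between \<open>y\<close> and \<open>z\<close>.
  A third neighbour \<open>u\<close> of \<open>v\<close> that is adjacent to \<open>x\<close> and \<open>y\<close> is then adjacent to \<open>w\<close> as well, by
  the matching property in the link of \<open>x\<close>. So \<open>x\<close>, \<open>y\<close> and \<open>w\<close> are vertices of the link of \<open>u\<close>, and
  \<open>y\<close> is nonadjacent to both of the others.
\<close>

lemma nonadjacent_unique:
  assumes V: "x \<in> V" "y \<in> V" "z \<in> V"
    and y: "x \<noteq> y" "\<not> adj x y" and z: "x \<noteq> z" "\<not> adj x z"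
  shows "y = z"
proof (rule ccontr)
  assume "y \<noteq> z"
  obtain v where v: "adj v x" "adj v y" using common_neighbour[OF V(1,2) y] .
  obtain w where w: "adj w x" "adj w z" using common_neighbour[OF V(1,3) z] .
  have vz: "\<not> adj v z" using adj_alternative[of v x y z] v y z \<open>y \<noteq> z\<close> by blast
  have wy: "\<not> adj w y" using adj_alternative[of w x y z] w y z \<open>y \<noteq> z\<close> by blast
  have neq: "v \<noteq> w" "w \<noteq> y" "w \<noteq> x"
    using v w vz z y adj_sym adj_irrefl by blast+
  have yx: "\<not> adj y x" "\<not> adj y w" using y wy adj_sym by blast+
  have vw: "\<not> adj v w"
    using adj_alternative[of v y x w] v yx neq y(1) by blast
  obtain u where u: "adj v u" "adj u x" "adj u y" using third_neighbour[OF v y] by blast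
  have "w \<noteq> u" using u(3) wy by blast
  moreover have "v \<noteq> u" using u(1) adj_irrefl by auto
  ultimately have "adj w v \<or> adj w u"
    using v w u neq by (intro adj_alternative[of x]) (auto intro: adj_sym)
  then have "adj u w" using vw adj_sym by blast
  then show False
    using adj_alternative[of u y x w] u yx neq y(1) by blast
qed

lemma small_nonfaces_disjoint:
  assumes F: "F \<in> MN" "card F = 2" and G: "G \<in> MN" "card G = 2"
    and x: "x \<in> F" "x \<in> G"
  shows "F = G"
proof -
  obtain y where y: "F = {x, y}" "x \<noteq> y"
    using F(2) x(1) by (metis card_2_iff doubleton_eq_iff empty_iff insertE)
  obtain z where z: "G = {x, z}" "x \<noteq> z"
    using G(2) x(2) by (metis card_2_iff doubleton_eq_iff empty_iff insertE)
  have "x \<in> V" "y \<in> V" "z \<in> V" "\<not> adj x y" "\<not> adj x z"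
    using y z minimal_nonfacesD(1,2)[OF F(1)] minimal_nonfacesD(1,2)[OF G(1)]
    by (auto simp: adj_def)
  then show ?thesis using nonadjacent_unique y z by blast
qed

lemma minimal_nonfaces_disjoint: "pairwise disjnt MN"
proof (rule pairwiseI, rule ccontr)
  fix F G
  assume F: "F \<in> MN" and G: "G \<in> MN" and neq: "F \<noteq> G" and "\<not> disjnt F G"
  then obtain x where x: "x \<in> F" "x \<in> G" by (auto simp: disjnt_iff)
  consider "card F = 2" "card G = 2" | "card F = 2" "card G \<ge> 3"
    | "card F \<ge> 3" "card G = 2" | "card F \<ge> 3" "card G \<ge> 3"
    using minimal_nonface_card[OF F] minimal_nonface_card[OF G] by linarith
  then show False
  proof cases
    case 1
    then show ?thesis using small_nonfaces_disjoint[OF F _ G _ x] neq by simp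
  next
    case 2
    then show ?thesis using large_small_nonfaces_disjoint[OF G _ F _ x(2,1)] by simp
  next
    case 3
    then show ?thesis using large_small_nonfaces_disjoint[OF F _ G _ x] by simp
  next
    case 4
    then show ?thesis using large_nonfaces_disjoint[OF F _ G _ x] neq by simp
  qed
qed

end


section \<open>One-dimensional complexes\<close>

locale locally_disjoint_complex_dim1 = locally_disjoint_complex V \<Delta>
  for V :: "'v set" and \<Delta> :: "'v set set" +
  assumes dim: "complex_dim \<Delta> = 1"
begin

lemma card_face_le: "F \<in> \<Delta> \<Longrightarrow> card F \<le> 2"
  using dim Max_ge[of "face_dim ` \<Delta>" "face_dim F"] finite_complex
  by (simp add: complex_dim_def face_dim_def)

lemma edge_exists: "\<exists>a b. adj a b"
proof -
  have "complex_dim \<Delta> \<in> face_dim ` \<Delta>"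
    unfolding complex_dim_def using finite_complex simplicial_complexD(2)[OF complex]
    by (intro Max_in) auto
  then obtain F where F: "F \<in> \<Delta>" "card F = 2"
    using dim by (auto simp: face_dim_def)
  then obtain a b where "F = {a, b}" "a \<noteq> b" by (auto simp: card_2_iff)
  then show ?thesis using F(1) by (auto simp: adj_def)
qed

lemma neighbour_exists:
  assumes "v \<in> V"
  shows "\<exists>w. adj v w"
proof -
  obtain a b where ab: "adj a b" using edge_exists by blast
  show ?thesis using adj_in_V(1)[OF ab] assms
  proof (induction rule: connected_induct)
    case base
    show ?case using ab by blast
  next
    case (step x y)
    then show ?case using adj_sym by blast
  qed
qed

lemma at_most_two_neighbours:
  assumes "adj v x" "adj v y" "adj v z" "x \<noteq> y" "x \<noteq> z" "y \<noteq> z"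
  shows False
proof -
  have "v \<noteq> x" "v \<noteq> y" "v \<noteq> z" using assms(1-3) by (auto simp: adj_def)
  then show False
    using triangle_alternative[OF assms] card_face_le[of "{v, x, y}"] card_face_le[of "{v, x, z}"]
      assms(4-6) by auto
qed

lemma facets_eq: "facets \<Delta> = {{x, y} | x y. adj x y}"
proof (intro subset_antisym subsetI)
  fix F assume "F \<in> facets \<Delta>"
  then have F: "F \<in> \<Delta>" and max: "\<And>G. G \<in> \<Delta> \<Longrightarrow> F \<subseteq> G \<Longrightarrow> G = F"
    by (auto simp: facets_def)
  obtain a b where ab: "adj a b" using edge_exists by blast
  have "F \<noteq> {}" using max[of "{a, b}"] ab by (auto simp: adj_def)
  then obtain x where x: "x \<in> F" by blast
  then have "x \<in> V" using face_sub[OF F] by blast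
  then obtain w where w: "adj x w" using neighbour_exists by blast
  have "F \<noteq> {x}" using max[of "{x, w}"] w by (auto simp: adj_def)
  then obtain y where y: "y \<in> F" "y \<noteq> x" using x by blast
  have adj_xy: "adj x y" using adj_of_face[OF F x y(1)] y(2) by simp
  have "finite F" using face_sub[OF F] simplicial_complexD(1)[OF complex] by (rule finite_subset)
  then have "{x, y} = F"
    using x y card_face_le[OF F] by (intro card_seteq) auto
  then show "F \<in> {{x, y} | x y. adj x y}" using adj_xy by blast
next
  fix F assume "F \<in> {{x, y} | x y. adj x y}"
  then obtain x y where F: "F = {x, y}" "adj x y" by blast
  have "G = F" if G: "G \<in> \<Delta>" "F \<subseteq> G" for G
  proof -
    have "finite G" using face_sub[OF G(1)] simplicial_complexD(1)[OF complex] by (rule finite_subset)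
    then show ?thesis
      using card_seteq[OF _ G(2)] card_face_le[OF G(1)] F by (simp add: adj_def)
  qed
  then show "F \<in> facets \<Delta>" using F by (simp add: facets_def adj_def)
qed

lemma pure_dim1: "pure_complex \<Delta>"
  by (auto simp: pure_complex_def facets_eq face_dim_def adj_def)

text \<open>
  A nonempty path in the 1-skeleton without repeated vertices. Since every vertex has at most two
  neighbours, a longest such path visits all vertices, and the only edge that it can omit is the one
  joining its end points.
\<close>

definition simple_path :: "'v list \<Rightarrow> bool" where
  "simple_path xs \<longleftrightarrow> xs \<noteq> [] \<and> distinct xs \<and> set xs \<subseteq> V \<and>
     (\<forall>i. Suc i < length xs \<longrightarrow> adj (xs ! i) (xs ! Suc i))"

lemma simple_path_adj_pred:
  assumes "simple_path xs" "0 < i" "i < length xs"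
  shows "adj (xs ! (i - 1)) (xs ! i)"
proof -
  have "Suc (i - 1) < length xs \<longrightarrow> adj (xs ! (i - 1)) (xs ! Suc (i - 1))"
    using assms(1) unfolding simple_path_def by blast
  then show ?thesis using assms(2,3) by simp
qed

lemma simple_path_rev:
  assumes "simple_path xs"
  shows "simple_path (rev xs)"
proof -
  have "adj (rev xs ! i) (rev xs ! Suc i)" if "Suc i < length xs" for i
  proof -
    have "adj (xs ! (length xs - Suc (Suc i))) (xs ! Suc (length xs - Suc (Suc i)))"
      using assms that unfolding simple_path_def by simp
    moreover have "Suc (length xs - Suc (Suc i)) = length xs - Suc i" using that by simp
    ultimately show ?thesis using that adj_sym by (simp add: rev_nth)
  qed
  then show ?thesis using assms by (simp add: simple_path_def)
qed

lemma simple_path_Cons: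
  assumes "simple_path xs" "adj (xs ! 0) w" "w \<notin> set xs"
  shows "simple_path (w # xs)"
proof -
  have "adj ((w # xs) ! i) ((w # xs) ! Suc i)" if "Suc i < length (w # xs)" for i
    using assms that adj_sym by (cases i) (auto simp: simple_path_def)
  then show ?thesis
    using assms adj_in_V(2)[OF assms(2)] by (simp add: simple_path_def)
qed

lemma longest_path_exists:
  "\<exists>xs. simple_path xs \<and> (\<forall>ys. simple_path ys \<longrightarrow> length ys \<le> length xs)"
proof -
  obtain a b where "adj a b" using edge_exists by blast
  then have "simple_path [a]" using adj_in_V(1) by (simp add: simple_path_def)
  moreover have "\<forall>ys. simple_path ys \<longrightarrow> length ys < Suc (card V)"
    using card_mono[OF simplicial_complexD(1)[OF complex]]
    by (auto simp: simple_path_def distinct_card[symmetric] less_Suc_eq_le)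
  ultimately show ?thesis
    by (rule Lattices_Big.ex_has_greatest_nat)
qed

lemma interior_neighbours:
  assumes xs: "simple_path xs" and i: "0 < i" "Suc i < length xs" and w: "adj (xs ! i) w"
  shows "w = xs ! (i - 1) \<or> w = xs ! Suc i"
proof (rule ccontr)
  assume no: "\<not> ?thesis"
  have "adj (xs ! i) (xs ! (i - 1))"
    using simple_path_adj_pred[OF xs, of i] i adj_sym by simp
  moreover have "adj (xs ! i) (xs ! Suc i)" using xs i by (simp add: simple_path_def)
  moreover have "xs ! (i - 1) \<noteq> xs ! Suc i"
    using xs i by (simp add: simple_path_def nth_eq_iff_index_eq)
  ultimately show False
    using at_most_two_neighbours[of "xs ! i" w "xs ! (i - 1)" "xs ! Suc i"] w no by simp
qed

lemma spanning_path:
  "\<exists>xs. simple_path xs \<and> set xs = V \<and>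
    (\<forall>i j. i < j \<and> j < length xs \<and> adj (xs ! i) (xs ! j) \<longrightarrow>
       j = Suc i \<or> i = 0 \<and> j = length xs - 1)"
proof -
  obtain xs where xs: "simple_path xs" and longest: "\<And>ys. simple_path ys \<Longrightarrow> length ys \<le> length xs"
    using longest_path_exists by (elim exE conjE) simp
  have dist: "distinct xs" and ne: "xs \<noteq> []" and sub: "set xs \<subseteq> V"
    using xs by (simp_all add: simple_path_def)
  have closed: "w \<in> set xs" if v: "v \<in> set xs" and w: "adj v w" for v w
  proof (rule ccontr)
    assume out: "w \<notin> set xs"
    obtain i where i: "i < length xs" "xs ! i = v" using v by (auto simp: in_set_conv_nth)
    consider "i = 0" | "i = length xs - 1" | "0 < i" "Suc i < length xs" using i(1) by linarith
    then show False
    proof cases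
      case 1
      then have "simple_path (w # xs)" using simple_path_Cons[OF xs] w out i by simp
      then show False using longest by fastforce
    next
      case 2
      then have "rev xs ! 0 = v" using i ne by (simp add: rev_nth)
      then have "simple_path (w # rev xs)"
        using simple_path_Cons[OF simple_path_rev[OF xs]] w out by simp
      then show False using longest by fastforce
    next
      case 3
      then have "w = xs ! (i - 1) \<or> w = xs ! Suc i"
        using interior_neighbours[OF xs] w i(2) by simp
      then show False using out 3 by auto
    qed
  qed
  have "V \<subseteq> set xs"
  proof
    fix v assume v: "v \<in> V"
    have "hd xs \<in> V" using ne sub by auto
    then show "v \<in> set xs" using v
      by (induction rule: connected_induct) (use ne closed in auto)
  qed
  moreover have "j = Suc i \<or> i = 0 \<and> j = length xs - 1"
    if ij: "i < j" "j < length xs" "adj (xs ! i) (xs ! j)" for i j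
  proof (rule ccontr)
    assume no: "\<not> ?thesis"
    show False
    proof (cases "i = 0")
      case False
      then have "xs ! j = xs ! (i - 1) \<or> xs ! j = xs ! Suc i"
        using ij by (intro interior_neighbours[OF xs]) auto
      then show False using dist ij no by (auto simp: nth_eq_iff_index_eq)
    next
      case True
      then have "xs ! i = xs ! (j - 1) \<or> xs ! i = xs ! Suc j"
        using ij no by (intro interior_neighbours[OF xs]) (auto intro: adj_sym)
      moreover have "Suc j < length xs" "j - 1 < length xs" "0 < j - 1"
        using ij no True by auto
      then have "xs ! 0 \<noteq> xs ! (j - 1)" "xs ! 0 \<noteq> xs ! Suc j"
        using nth_eq_iff_index_eq[OF dist, of 0 "j - 1"] nth_eq_iff_index_eq[OF dist, of 0 "Suc j"]
          ne by simp_all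
      ultimately show False using True by simp
    qed
  qed
  ultimately show ?thesis using xs sub by (intro exI[of _ xs] conjI subset_antisym) simp_all
qed

lemma gon_or_path:
  "(\<exists>m\<ge>3. is_gon m V \<Delta>) \<or> (\<exists>m\<ge>2. is_pointed_path m V \<Delta>)"
proof -
  obtain xs where xs: "simple_path xs" and V: "set xs = V"
    and edges: "\<And>i j. i < j \<Longrightarrow> j < length xs \<Longrightarrow> adj (xs ! i) (xs ! j) \<Longrightarrow>
       j = Suc i \<or> i = 0 \<and> j = length xs - 1"
    using spanning_path by (elim exE conjE) simp
  define m where "m = length xs"
  \<comment> \<open>The relabelling is by \<open>{1..m}\<close>, whereas list positions start at \<open>0\<close>.\<close>
  define f where "f k = xs ! (k - 1)" for k
  have dist: "distinct xs" using xs by (simp add: simple_path_def)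
  have f_bij: "bij_betw f {1..m} V"
  proof -
    have "bij_betw (\<lambda>k. k - 1) {1..m} {..<m}"
      by (rule bij_betw_byWitness[of _ Suc]) auto
    moreover have "bij_betw ((!) xs) {..<m} V"
      using bij_betw_nth[OF dist _ V[symmetric]] by (simp add: m_def)
    ultimately have "bij_betw ((!) xs \<circ> (\<lambda>k. k - 1)) {1..m} V"
      by (rule bij_betw_trans)
    then show ?thesis by (simp add: f_def[abs_def] comp_def)
  qed
  let ?P = "{{i, i + 1} | i. i \<in> {1..<m}}"
  have path_edges: "(`) f ` ?P \<subseteq> facets \<Delta>"
  proof
    fix F assume "F \<in> (`) f ` ?P"
    then obtain i where i: "i \<in> {1..<m}" "F = {f i, f (i + 1)}" by auto
    then have "adj (xs ! (i - 1)) (xs ! i)"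
      by (intro simple_path_adj_pred[OF xs]) (simp_all add: m_def)
    then have "adj (f i) (f (i + 1))" using i(1) by (simp add: f_def)
    then show "F \<in> facets \<Delta>" using i(2) by (auto simp: facets_eq)
  qed
  have facet_cases: "F \<in> (`) f ` ?P \<or> F = {f m, f 1} \<and> adj (f 1) (f m) \<and> m \<ge> 3"
    if facet: "F \<in> facets \<Delta>" for F
  proof -
    obtain x y where F: "F = {x, y}" "adj x y" using facet by (auto simp: facets_eq)
    obtain i j where ij: "i < length xs" "xs ! i = x" "j < length xs" "xs ! j = y"
      using adj_in_V[OF F(2)] V by (metis in_set_conv_nth)
    have "i \<noteq> j" using ij F(2) adj_irrefl by auto
    then obtain a b where ab: "a < b" "b < m" "F = {xs ! a, xs ! b}" "adj (xs ! a) (xs ! b)"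
    proof (cases "i < j")
      case True
      then show ?thesis using that[of i j] ij F by (simp add: m_def)
    next
      case False
      then show ?thesis
        using that[of j i] ij F adj_sym \<open>i \<noteq> j\<close> by (simp add: m_def insert_commute)
    qed
    show ?thesis
    proof (cases "b = Suc a")
      case True
      have "F = f ` {b, b + 1}" using ab(3) True by (simp add: f_def)
      moreover have "{b, b + 1} \<in> ?P" using True ab(2) by auto
      ultimately show ?thesis by blast
    next
      case False
      then have "a = 0" "b = m - 1" using edges[of a b] ab by (auto simp: m_def)
      then show ?thesis using ab False by (auto simp: f_def)
    qed
  qed
  have "m \<ge> 2"
  proof -
    obtain x y where "adj x y" using edge_exists by blast
    then have "{x, y} \<in> facets \<Delta>" by (auto simp: facets_eq)
    then show ?thesis using facet_cases by fastforce
  qed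
  show ?thesis
  proof (cases "m \<ge> 3 \<and> adj (f 1) (f m)")
    case True
    then have "{f m, f 1} \<in> facets \<Delta>" using adj_sym by (auto simp: facets_eq)
    then have "facets \<Delta> = (`) f ` (?P \<union> {{m, 1}})"
      using path_edges facet_cases unfolding image_Un by auto
    then have "is_gon m V \<Delta>" using f_bij dim pure_dim1 by (auto simp: is_gon_def)
    then show ?thesis using True by blast
  next
    case False
    then have "facets \<Delta> = (`) f ` ?P"
      using path_edges facet_cases by blast
    then have "is_pointed_path m V \<Delta>" using f_bij dim pure_dim1 by (auto simp: is_pointed_path_def)
    then show ?thesis using \<open>m \<ge> 2\<close> by blast
  qed
qed

end

section \<open>Locally complete intersection complexes\<close>

lemma link_complex:
  assumes complex: "simplicial_complex V \<Delta>" and v: "v \<in> V"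
  shows "simplicial_complex (vertices (link \<Delta> {v})) (link \<Delta> {v})"
proof -
  note down = simplicial_complexD(5)[OF complex]
  have sub: "vertices (link \<Delta> {v}) \<subseteq> V"
    using simplicial_complexD(3)[OF complex] by (auto simp: vertices_def link_def)
  have down': "G \<in> link \<Delta> {v}" if "F \<in> link \<Delta> {v}" "G \<subseteq> F" for F G
    using that down[of F G] down[of "F \<union> {v}" "G \<union> {v}"] by (auto simp: link_def)
  have "{} \<in> link \<Delta> {v}"
    using simplicial_complexD(2,4)[OF complex] v by (simp add: link_def)
  moreover have "F \<subseteq> vertices (link \<Delta> {v})" if "F \<in> link \<Delta> {v}" for F
    using down'[OF that] by (auto simp: vertices_def)
  ultimately show ?thesis
    using finite_subset[OF sub simplicial_complexD(1)[OF complex]] down'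
    unfolding simplicial_complex_def by (auto simp: vertices_def)
qed

lemma locally_complete_intersection_imp_locally_disjoint:
  assumes "simplicial_complex V \<Delta>" and "connected_complex V \<Delta>"
    and "locally_complete_intersection_complex TYPE('k::field) V \<Delta>"
  shows "locally_disjoint_complex V \<Delta>"
proof
  fix v assume v: "v \<in> V"
  show "pairwise disjnt (minimal_nonfaces (vertices (link \<Delta> {v})) (link \<Delta> {v}))"
    using complete_intersection_imp_disjoint[OF link_complex[OF assms(1) v]] assms(3) v
    by (auto simp: locally_complete_intersection_complex_def)
qed (fact assms)+

theorem theorem1:
  fixes n :: nat and \<Delta> :: "nat set set"
  assumes "simplicial_complex {1..n} \<Delta>"
    and "connected_complex {1..n} \<Delta>"
    and "locally_complete_intersection_complex TYPE('k::field) {1..n} \<Delta>"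
  shows "(complex_dim \<Delta> \<ge> 2 \<longrightarrow> complete_intersection_complex TYPE('k) {1..n} \<Delta>) \<and>
         (complex_dim \<Delta> = 1 \<longrightarrow>
            (\<exists>m\<ge>3. is_gon m {1..n} \<Delta>) \<or> (\<exists>m\<ge>2. is_pointed_path m {1..n} \<Delta>))"
proof -
  interpret locally_disjoint_complex "{1..n}" \<Delta>
    using assms by (rule locally_complete_intersection_imp_locally_disjoint)
  show ?thesis
  proof (intro conjI impI)
    assume "complex_dim \<Delta> \<ge> 2"
    then interpret locally_disjoint_complex_dim2 "{1..n}" \<Delta> by unfold_locales
    show "complete_intersection_complex TYPE('k) {1..n} \<Delta>"
      using assms(1) minimal_nonfaces_disjoint by (rule disjoint_imp_complete_intersection)
  next
    assume "complex_dim \<Delta> = 1"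
    then interpret locally_disjoint_complex_dim1 "{1..n}" \<Delta> by unfold_locales
    show "(\<exists>m\<ge>3. is_gon m {1..n} \<Delta>) \<or> (\<exists>m\<ge>2. is_pointed_path m {1..n} \<Delta>)"
      by (rule gon_or_path)
  qed
qed

end
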